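(* For every $\alpha\in(1,2)$, the random variable $\mathcal{A}_\alpha=\int_0^T L^{(\alpha)}_s\,ds$, where $L^{(\alpha)}$ is the strictly $\alpha$-stable Lévy process without negative jumps starting from one (normalized as in the context) and $T=\inf\{t>0:\ L^{(\alpha)}_t=0\}$, is self-decomposable.
   Context: For $\alpha\in(1,2)$, $\{L^{(\alpha)}_t,\ t\ge 0\}$ denotes a strictly $\alpha$-stable Lévy process without negative jumps (spectrally positive), started from $L^{(\alpha)}_0=1$, with the normalization $\mathbb{E}[e^{-\lambda (L^{(\alpha)}_1-L^{(\alpha)}_0)}]=e^{\lambda^\alpha}$ for all $\lambda\ge 0$. A non-negative random variable $X$ is called self-decomposable if for every $c\in(0,1)$ there is a random variable $X_c$, independent of $X$, such that $X\stackrel{d}{=}cX+X_c$ (equality in law). Equivalently, its log-Laplace transform is of the form $-\log\mathbb{E}[e^{-\lambda X}]=a\lambda+\int_0^\infty(1-e^{-\lambda x})\frac{k(x)}{x}\,dx$, $\lambda\ge 0$, for some $a\ge 0$ and some non-negative, non-increasing function $k$ on $(0,\infty)$ with $\int_0^\infty (1\wedge x^{-1})k(x)\,dx<\infty$. *)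

theory Defs
  imports "HOL-Probability.Probability"
begin

text \<open>Processes indexed by \<open>t \<ge> 0\<close> are functions \<open>L :: real \<Rightarrow> 'w \<Rightarrow> real\<close>; values at negative
  times are ignored throughout.\<close>

definition cadlag :: "(real \<Rightarrow> real) \<Rightarrow> bool" where
  "cadlag f \<longleftrightarrow>
     (\<forall>t\<ge>0. (f \<longlongrightarrow> f t) (at_right t)) \<and>
     (\<forall>t>0. \<exists>l. (f \<longlongrightarrow> l) (at_left t))"

definition no_negative_jumps :: "(real \<Rightarrow> real) \<Rightarrow> bool" where
  "no_negative_jumps f \<longleftrightarrow> (\<forall>t>0. \<forall>l. (f \<longlongrightarrow> l) (at_left t) \<longrightarrow> l \<le> f t)"

definition independent_increments :: "'w measure \<Rightarrow> (real \<Rightarrow> 'w \<Rightarrow> real) \<Rightarrow> bool" where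
  "independent_increments M L \<longleftrightarrow>
     (\<forall>(n::nat) (t :: nat \<Rightarrow> real). 0 \<le> t 0 \<and> mono t \<longrightarrow>
        prob_space.indep_vars M (\<lambda>_. borel) (\<lambda>i \<omega>. L (t (Suc i)) \<omega> - L (t i) \<omega>) {..<n})"

definition stationary_increments :: "'w measure \<Rightarrow> (real \<Rightarrow> 'w \<Rightarrow> real) \<Rightarrow> bool" where
  "stationary_increments M L \<longleftrightarrow>
     (\<forall>s\<ge>0. \<forall>t\<ge>0. distr M borel (\<lambda>\<omega>. L (s + t) \<omega> - L s \<omega>) = distr M borel (\<lambda>\<omega>. L t \<omega> - L 0 \<omega>))"

text \<open>Stochastic continuity is not listed because it follows from stationarity of the increments
  and right-continuity of the paths.\<close>

definition levy_process_from :: "real \<Rightarrow> 'w measure \<Rightarrow> (real \<Rightarrow> 'w \<Rightarrow> real) \<Rightarrow> bool" where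
  "levy_process_from x M L \<longleftrightarrow>
     prob_space M \<and>
     (\<forall>t\<ge>0. L t \<in> borel_measurable M) \<and>
     (AE \<omega> in M. L 0 \<omega> = x) \<and>
     independent_increments M L \<and>
     stationary_increments M L \<and>
     (AE \<omega> in M. cadlag (\<lambda>t. L t \<omega>))"

text \<open>Scaling is required of the one-dimensional marginals only; for a Levy process these
  determine the law of the whole process.\<close>

definition strictly_stable :: "real \<Rightarrow> 'w measure \<Rightarrow> (real \<Rightarrow> 'w \<Rightarrow> real) \<Rightarrow> bool" where
  "strictly_stable \<alpha> M L \<longleftrightarrow>
     (\<forall>a>0. \<forall>t\<ge>0. distr M borel (\<lambda>\<omega>. L (a * t) \<omega> - L 0 \<omega>)
                  = distr M borel (\<lambda>\<omega>. a powr (1 / \<alpha>) * (L t \<omega> - L 0 \<omega>)))"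

definition spectrally_positive_stable_from_one ::
    "real \<Rightarrow> 'w measure \<Rightarrow> (real \<Rightarrow> 'w \<Rightarrow> real) \<Rightarrow> bool" where
  "spectrally_positive_stable_from_one \<alpha> M L \<longleftrightarrow>
     levy_process_from 1 M L \<and>
     strictly_stable \<alpha> M L \<and>
     (AE \<omega> in M. no_negative_jumps (\<lambda>t. L t \<omega>)) \<and>
     (\<forall>u\<ge>0. prob_space.expectation M (\<lambda>\<omega>. exp (- u * (L 1 \<omega> - L 0 \<omega>))) = exp (u powr \<alpha>))"

text \<open>Extended-real valued, so that the infimum is \<open>\<infinity>\<close> on paths that never hit zero.\<close>

definition hitting_time_zero :: "(real \<Rightarrow> real) \<Rightarrow> ereal" where
  "hitting_time_zero f = Inf (ereal ` {t. 0 < t \<and> f t = 0})"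

text \<open>The first hitting time of a point by a process with cadlag paths need not be measurable with
  respect to a sigma-algebra that lacks the null sets, so the area below is a random variable on
  the completion of the underlying probability space.\<close>

definition area_until_zero :: "(real \<Rightarrow> 'w \<Rightarrow> real) \<Rightarrow> 'w \<Rightarrow> real" where
  "area_until_zero L \<omega> = (LBINT s=0..hitting_time_zero (\<lambda>t. L t \<omega>). L s \<omega>)"

text \<open>The space carrying \<open>X\<close> may be too small to carry an independent \<open>X\<^sub>c\<close> (it may be generated by
  \<open>X\<close> itself), so a copy \<open>Y\<close> of \<open>X\<close> and an independent \<open>Z\<close> in the role of \<open>X\<^sub>c\<close> are taken on an
  auxiliary space \<open>N\<close>. Points of type \<^typ>\<open>real \<times> real\<close> are no restriction, since only the joint
  law of \<open>(Y, Z)\<close> matters.\<close>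

definition self_decomposable :: "'w measure \<Rightarrow> ('w \<Rightarrow> real) \<Rightarrow> bool" where
  "self_decomposable M X \<longleftrightarrow>
     prob_space M \<and> X \<in> borel_measurable M \<and> (AE \<omega> in M. 0 \<le> X \<omega>) \<and>
     (\<forall>c. 0 < c \<and> c < 1 \<longrightarrow>
        (\<exists>(N :: (real \<times> real) measure) Y Z.
           prob_space N \<and>
           prob_space.indep_var N borel Y borel Z \<and>
           distr N borel Y = distr M borel X \<and>
           distr M borel X = distr N borel (\<lambda>\<omega>. c * Y \<omega> + Z \<omega>)))"

end

(* Without negative jumps, a path started from 1 passes continuously through every level c in (0, 1)
   on its way to 0, and the area splits at that passage time into the part before and the part
   after. By the strong Markov property the part after is independent of the part before, and by
   scaling it is distributed as c^(\<alpha> + 1) times the whole area; c^(\<alpha> + 1) takes all values in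
   (0, 1).

   The strong Markov property is obtained by sampling the path along a grid of mesh h. There it is
   an exact identity for random walks, expressed through an infinite product of step laws, and
   right continuity of the paths allows h to tend to 0 in the passage times and in the Riemann sums
   for the areas. The factorisation is only needed for characteristic functions. *)

theory Submission
  imports Defs
begin

subsection \<open>Passage of cadlag paths below zero\<close>

text \<open>A grid would miss an isolated zero of the path. The passage time used throughout is
  therefore the first entry into the open half line below zero: a right continuous path that is
  negative stays negative long enough for a fine grid to notice. That this time agrees with the
  hitting time of zero is a separate almost sure fact. The sampled walk does not stop at the level c
  but somewhere below it. The second walk is nevertheless started exactly from c, because it must be
  independent of the first one. It then runs above the path by a gap that vanishes with the mesh,
  and convergence has to be proved with this gap in place. The area before the passage contains a
  rectangle of height c whose width is the passage time, so time and area are carried along as a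
  pair. The exponent \<alpha> + 1 consists of one power of c for space and \<alpha> powers for
  time.\<close>

lemma cadlag_bounded:
  assumes "cadlag f" "a \<le> b"
  obtains C where "\<And>t. \<lbrakk>0 \<le> t; a \<le> t; t \<le> b\<rbrakk> \<Longrightarrow> \<bar>f t\<bar> \<le> C"
proof -
  have "\<exists>C. \<forall>t. 0 \<le> t \<and> a \<le> t \<and> t \<le> b \<longrightarrow> \<bar>f t\<bar> \<le> C"
    using \<open>a \<le> b\<close>
  proof (induction rule: Bolzano)
    case (trans p q r)
    then obtain C D where "\<forall>t. 0 \<le> t \<and> p \<le> t \<and> t \<le> q \<longrightarrow> \<bar>f t\<bar> \<le> C"
      "\<forall>t. 0 \<le> t \<and> q \<le> t \<and> t \<le> r \<longrightarrow> \<bar>f t\<bar> \<le> D" by blast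
    then have "\<forall>t. 0 \<le> t \<and> p \<le> t \<and> t \<le> r \<longrightarrow> \<bar>f t\<bar> \<le> max C D"
      by (metis le_max_iff_disj nle_le)
    then show ?case by blast
  next
    \<comment> \<open>Right continuity bounds \<open>f\<close> just after \<open>x\<close>, the left
      limit bounds it just before; bisection then covers the interval. Nothing is known at negative
      times, so they are excluded.\<close>
    case (local x)
    show ?case
    proof (cases "0 \<le> x")
      case False
      then have "\<forall>p q. p \<le> x \<and> x \<le> q \<and> q - p < - x \<longrightarrow>
          (\<forall>t. 0 \<le> t \<and> p \<le> t \<and> t \<le> q \<longrightarrow> \<bar>f t\<bar> \<le> 0)" by auto
      with False show ?thesis by (intro exI[of _ "- x"]) auto
    next
      case True
      have R: "(f \<longlongrightarrow> f x) (at_right x)" using assms(1) True by (auto simp: cadlag_def)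
      then have "eventually (\<lambda>t. \<bar>f t - f x\<bar> < 1) (at_right x)"
        by (auto dest: tendstoD[where e=1] simp: dist_real_def)
      then obtain e where e: "e > x" "\<And>t. x < t \<Longrightarrow> t < e \<Longrightarrow> \<bar>f t - f x\<bar> < 1"
        by (auto simp: eventually_at_right_field)
      obtain d C where d: "d < x" "\<And>t. d < t \<Longrightarrow> t < x \<Longrightarrow> 0 \<le> t \<Longrightarrow> \<bar>f t\<bar> \<le> C"
      proof (cases "x = 0")
        case True
        show thesis by (rule that[of "x - 1" 0]) (use True in auto)
      next
        case False
        with \<open>0 \<le> x\<close> assms(1) obtain l where "(f \<longlongrightarrow> l) (at_left x)"
          by (force simp: cadlag_def)
        then have "eventually (\<lambda>t. \<bar>f t - l\<bar> < 1) (at_left x)"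
          by (auto dest: tendstoD[where e=1] simp: dist_real_def)
        then obtain d where "d < x" "\<And>t. d < t \<Longrightarrow> t < x \<Longrightarrow> \<bar>f t - l\<bar> < 1"
          by (auto simp: eventually_at_left_field)
        then show thesis by (intro that[of d "\<bar>l\<bar> + 1"]) force+
      qed
      define D where "D = max C (\<bar>f x\<bar> + 1)"
      have "\<bar>f t\<bar> \<le> D" if "0 \<le> t" "d < t" "t < e" for t
        using e(2)[of t] d(2)[of t] that by (cases t x rule: linorder_cases) (auto simp: D_def)
      then show ?thesis
        by (intro exI[of _ "min (e - x) (x - d)"] conjI allI impI exI[of _ D])
           (use e(1) d(1) in auto)
    qed
  qed
  then show thesis using that by blast
qed

section \<open>Right Riemann sums of cadlag functions\<close>

lemma cadlag_right_seq:
  assumes "cadlag f" "0 \<le> t" "\<And>n. t \<le> p n" "p \<longlonglongrightarrow> t"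
  shows "(\<lambda>n. f (p n)) \<longlonglongrightarrow> f t"
proof -
  have "continuous (at t within {t..}) f"
    using assms(1,2) by (simp add: cadlag_def continuous_within at_within_Ici_at_right)
  from continuous_within_tendsto_compose[OF this _ assms(4)] assms(3)
  show ?thesis by simp
qed

text \<open>Turns a right Riemann sum into an integral, to which dominated convergence applies; the
  ceiling sends each point of a cell to the right end of that cell.\<close>

lemma has_bochner_integral_right_step:
  fixes f :: "real \<Rightarrow> real"
  assumes h: "0 < h"
  shows "has_bochner_integral lborel
     (\<lambda>s. indicator {a<..a + h * real K} s * f (a + h * of_int \<lceil>(s - a) / h\<rceil>))
     (h * (\<Sum>k<K. f (a + h * real (Suc k))))"
proof (induction K)
  case 0
  then show ?case by (simp add: has_bochner_integral_zero)
next
  case (Suc K)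
  let ?J = "{a + h * real K<..a + h * real (Suc K)}"
  have "has_bochner_integral lborel (indicator ?J) (measure lborel ?J)"
    using h by (intro has_bochner_integral_real_indicator) (auto simp: emeasure_lborel_Ioc)
  then have "has_bochner_integral lborel (\<lambda>s. indicator ?J s * f (a + h * real (Suc K)))
      (measure lborel ?J * f (a + h * real (Suc K)))"
    by (rule has_bochner_integral_mult_left)
  moreover have "measure lborel ?J = h" using h by (simp add: algebra_simps)
  ultimately have "has_bochner_integral lborel (\<lambda>s. indicator ?J s * f (a + h * real (Suc K)))
      (h * f (a + h * real (Suc K)))" by simp
  from has_bochner_integral_add[OF Suc this]
  have "has_bochner_integral lborel (\<lambda>s. indicator {a<..a + h * real K} s * f (a + h * of_int \<lceil>(s - a) / h\<rceil>)
        + indicator ?J s * f (a + h * real (Suc K)))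
     (h * (\<Sum>k<Suc K. f (a + h * real (Suc k))))"
    by (simp add: distrib_left)
  moreover have "indicator {a<..a + h * real K} s * f (a + h * of_int \<lceil>(s - a) / h\<rceil>)
        + indicator ?J s * f (a + h * real (Suc K))
      = indicator {a<..a + h * real (Suc K)} s * f (a + h * of_int \<lceil>(s - a) / h\<rceil>)" for s
  proof (cases "s \<in> ?J")
    case True
    then have "real K < (s - a) / h" "(s - a) / h \<le> real K + 1"
      using h by (auto simp: field_simps)
    then have "\<lceil>(s - a) / h\<rceil> = int (Suc K)" by (intro ceiling_unique) auto
    moreover have "s \<notin> {a<..a + h * real K}" "s \<in> {a<..a + h * real (Suc K)}"
      using True h by (auto intro: le_less_trans[OF _ conjunct1] simp: add_pos_nonneg)
        (smt (verit) mult_nonneg_nonneg of_nat_0_le_iff)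
    ultimately show ?thesis using True by simp
  next
    case False
    then have "s \<in> {a<..a + h * real K} \<longleftrightarrow> s \<in> {a<..a + h * real (Suc K)}"
      using h by (auto simp: algebra_simps)
    with False show ?thesis by (simp add: indicator_def)
  qed
  ultimately show ?case by simp
qed

text \<open>The grid point following \<open>s\<close> tends to \<open>s\<close> from the right, so
  the step functions converge by right continuity, and local boundedness dominates them. Origin and
  length of the grid vary with \<open>n\<close> because both will be given by passage times of
  walks.\<close>

lemma right_riemann_sum_tendsto:
  fixes K :: "nat \<Rightarrow> nat"
  assumes f: "cadlag f" and a: "0 \<le> a" "\<And>n. a \<le> a' n" "a' \<longlonglongrightarrow> a"
    and h: "\<And>n. 0 < h n" "h \<longlonglongrightarrow> 0"
    and b: "(\<lambda>n. a' n + h n * real (K n)) \<longlonglongrightarrow> b"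
  shows "set_integrable lborel {a<..<b} f" (is ?thesis1)
    and "(\<lambda>n. h n * (\<Sum>k<K n. f (a' n + h n * real (Suc k)))) \<longlonglongrightarrow> (LINT t:{a<..<b}|lborel. f t)"
      (is ?thesis2)
proof -
  define p where "p n s = a' n + h n * of_int \<lceil>(s - a' n) / h n\<rceil>" for n s
  define g where "g n s = indicator {a' n<..a' n + h n * real (K n)} s * f (p n s)" for n s
  have p: "s \<le> p n s \<and> p n s < s + h n" for n s
  proof -
    define q where "q = (s - a' n) / h n"
    have s: "s = a' n + h n * q" using h(1)[of n] by (simp add: q_def)
    have "h n * q \<le> h n * of_int \<lceil>q\<rceil>" "h n * of_int \<lceil>q\<rceil> < h n * (q + 1)"
      using h(1)[of n] by (intro mult_left_mono mult_strict_left_mono; linarith)+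
    then show ?thesis by (simp add: p_def q_def[symmetric]) (simp add: s algebra_simps)
  qed
  have p_lim: "(\<lambda>n. p n s) \<longlonglongrightarrow> s" for s
  proof (rule tendsto_sandwich[of "\<lambda>_. s" _ _ "\<lambda>n. s + h n"])
    show "(\<lambda>n. s + h n) \<longlonglongrightarrow> s" using tendsto_add[OF tendsto_const h(2), of s] by simp
  qed (use p in \<open>auto intro!: always_eventually less_imp_le\<close>)
  have fp: "(\<lambda>n. f (p n s)) \<longlonglongrightarrow> f s" if "0 \<le> s" for s
    by (rule cadlag_right_seq[OF f that _ p_lim]) (use p in auto)
  have meas[measurable]: "(\<lambda>s. f (p n s)) \<in> borel_measurable borel" for n
    unfolding p_def
    by (rule measurable_compose[where f="\<lambda>s. \<lceil>(s - a' n) / h n\<rceil>" and N="count_space UNIV"]) measurable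
  have [measurable]: "g n \<in> borel_measurable borel" for n
    unfolding g_def by measurable
  \<comment> \<open>At \<open>b\<close> the indicators may oscillate; convergence is claimed off the
    two end points, which form a null set.\<close>
  have ind_lim: "(\<lambda>n. indicator {a' n<..a' n + h n * real (K n)} s :: real) \<longlonglongrightarrow> indicator {a<..<b} s"
    if ne: "s \<noteq> a" "s \<noteq> b" for s
  proof -
    have "eventually (\<lambda>n. indicator {a' n<..a' n + h n * real (K n)} s = (indicator {a<..<b} s :: real)) sequentially"
    proof -
      consider "s < a" | "s > b" | "a < s" "s < b" using ne by linarith
      then show ?thesis
      proof cases
        case 1
        then have "\<not> a' n < s" for n using a(2)[of n] by simp
        with 1 show ?thesis by (intro always_eventually) (auto simp: indicator_def)
      next
        case 2
        from order_tendstoD(2)[OF b 2] show ?thesis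
          by eventually_elim (use 2 in \<open>auto simp: indicator_def\<close>)
      next
        case 3
        from order_tendstoD(1)[OF b 3(2)] order_tendstoD(2)[OF a(3) 3(1)] show ?thesis
          by eventually_elim (use 3 in \<open>auto simp: indicator_def\<close>)
      qed
    qed
    then show ?thesis by (rule tendsto_eventually)
  qed
  have g_lim: "(\<lambda>n. g n s) \<longlonglongrightarrow> indicator {a<..<b} s * f s" if "s \<noteq> a" "s \<noteq> b" for s
  proof (cases "0 \<le> s")
    case True
    then show ?thesis unfolding g_def by (intro tendsto_mult ind_lim fp that)
  next
    case False
    then have "g n s = 0" for n using a(1) a(2)[of n] by (auto simp: g_def indicator_def)
    moreover have "indicator {a<..<b} s = (0::real)" using False a(1) by auto
    ultimately show ?thesis by simp
  qed
  \<comment> \<open>Measurability of \<open>f\<close> on the interval is itself a consequence of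
    right continuity: \<open>f\<close> is there a pointwise limit of step functions.\<close>
  have lim_meas[measurable]: "(\<lambda>s. indicator {a<..<b} s * f s) \<in> borel_measurable borel"
  proof (rule borel_measurable_LIMSEQ_metric)
    show "(\<lambda>s. indicator {a<..<b} s * f (p n s)) \<in> borel_measurable borel" for n by measurable
    show "(\<lambda>n. indicator {a<..<b} s * f (p n s)) \<longlonglongrightarrow> indicator {a<..<b} s * f s" for s
      using a(1) by (cases "s \<in> {a<..<b}") (auto intro!: fp)
  qed
  have "Bseq (\<lambda>n. a' n + h n * real (K n))" using b by (auto intro: convergent_imp_Bseq convergentI)
  then obtain B where B: "\<And>n. \<bar>a' n + h n * real (K n)\<bar> \<le> B" unfolding Bseq_def by auto
  have "Bseq h" using h by (auto intro: convergent_imp_Bseq convergentI)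
  then obtain H where H: "\<And>n. \<bar>h n\<bar> \<le> H" unfolding Bseq_def by auto
  have "0 \<le> B" using B[of 0] by linarith
  moreover have "0 \<le> H" using H[of 0] by linarith
  ultimately have "0 \<le> B + H" by simp
  \<comment> \<open>The right end point of a cell may lie up to one mesh beyond \<open>B\<close>,
    hence the extra \<open>H\<close>.\<close>
  from cadlag_bounded[OF f this] obtain C where C: "\<And>t. 0 \<le> t \<Longrightarrow> t \<le> B + H \<Longrightarrow> \<bar>f t\<bar> \<le> C"
    by metis
  have dom: "norm (g n s) \<le> indicator {0..B} s * C" for n s
  proof (cases "s \<in> {a' n<..a' n + h n * real (K n)}")
    case True
    then have "0 \<le> s" "s \<le> B" using a(1) a(2)[of n] B[of n] by auto
    moreover have "\<bar>f (p n s)\<bar> \<le> C" using p[of s n] H[of n] calculation by (intro C) linarith+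
    ultimately show ?thesis using True by (simp add: g_def)
  next
    case False
    have "0 \<le> C" using C[of 0] \<open>0 \<le> B + H\<close> by (smt (verit))
    with False show ?thesis by (auto simp: g_def indicator_def)
  qed
  have intC: "integrable lborel (\<lambda>s. indicator {0..B} s * C)"
    by (intro integrable_mult_left integrable_real_indicator) (auto simp: emeasure_lborel_Icc_eq)
  have AE: "AE s in lborel. (\<lambda>n. g n s) \<longlonglongrightarrow> indicator {a<..<b} s * f s"
    using AE_lborel_singleton[of a] AE_lborel_singleton[of b] by eventually_elim (rule g_lim)
  have 1: "integrable lborel (\<lambda>s. indicator {a<..<b} s * f s)"
    by (rule integrable_dominated_convergence[OF _ _ intC AE]) (use dom in auto)
  then show ?thesis1 by (simp add: set_integrable_def)
  have "(\<lambda>n. integral\<^sup>L lborel (g n)) \<longlonglongrightarrow> integral\<^sup>L lborel (\<lambda>s. indicator {a<..<b} s * f s)"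
    by (rule integral_dominated_convergence[OF _ _ intC AE]) (use dom in auto)
  moreover have "integral\<^sup>L lborel (g n) = h n * (\<Sum>k<K n. f (a' n + h n * real (Suc k)))" for n
    unfolding g_def p_def
    by (rule has_bochner_integral_integral_eq[OF has_bochner_integral_right_step[OF h(1)]])
  ultimately show ?thesis2 by (simp add: set_lebesgue_integral_def)
qed

section \<open>First passage below zero\<close>

definition goes_neg :: "(real \<Rightarrow> real) \<Rightarrow> bool" where
  "goes_neg f \<longleftrightarrow> (\<exists>t\<ge>0. f t < 0)"

text \<open>On a function that never goes negative this is the infimum of the empty set and carries
  no information; hence the separate predicate \<open>goes_neg\<close>.\<close>

definition first_neg :: "(real \<Rightarrow> real) \<Rightarrow> real" where
  "first_neg f = Inf {t. 0 \<le> t \<and> f t < 0}"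

lemma first_neg_le: "0 \<le> t \<Longrightarrow> f t < 0 \<Longrightarrow> first_neg f \<le> t"
  unfolding first_neg_def by (rule cInf_lower) (auto intro: bdd_belowI[of _ 0])

lemma first_neg_ge: "goes_neg f \<Longrightarrow> (\<And>t. 0 \<le> t \<Longrightarrow> f t < 0 \<Longrightarrow> a \<le> t) \<Longrightarrow> a \<le> first_neg f"
  unfolding first_neg_def goes_neg_def by (rule cInf_greatest) auto

lemma first_neg_nonneg: "goes_neg f \<Longrightarrow> 0 \<le> first_neg f"
  by (rule first_neg_ge)

lemma before_first_neg: "0 \<le> t \<Longrightarrow> t < first_neg f \<Longrightarrow> 0 \<le> f t"
  using first_neg_le[of t f] by force

lemma first_neg_approx:
  assumes "goes_neg f" "first_neg f < u"
  obtains t where "0 \<le> t" "first_neg f \<le> t" "t < u" "f t < 0"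
proof -
  have "{t. 0 \<le> t \<and> f t < 0} \<noteq> {}" using assms(1) by (auto simp: goes_neg_def)
  from cInf_lessD[OF this] assms(2) obtain t where "0 \<le> t" "f t < 0" "t < u"
    by (auto simp: first_neg_def)
  then show thesis using that first_neg_le by blast
qed

text \<open>Negative values accumulate at the passage time from the right or occur at it, so right
  continuity gives a value at most 0. The left limit is at least 0, and a path without negative
  jumps cannot drop below it. Hence the path continues from exactly the level that it
  passes.\<close>

lemma first_neg_eq_0:
  assumes f: "cadlag f" "no_negative_jumps f" "goes_neg f" "0 < f 0"
  shows "0 < first_neg f" "f (first_neg f) = 0"
proof -
  let ?t = "first_neg f"
  have t0: "0 \<le> ?t" using f(3) by (rule first_neg_nonneg)
  have rc: "(f \<longlongrightarrow> f ?t) (at_right ?t)" using f(1) t0 by (auto simp: cadlag_def)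
  have le: "f ?t \<le> 0"
  proof (rule ccontr)
    assume "\<not> f ?t \<le> 0"
    then have pos: "0 < f ?t" by simp
    from order_tendstoD(1)[OF rc pos] obtain e where
      "e > ?t" "\<And>t. ?t < t \<Longrightarrow> t < e \<Longrightarrow> 0 < f t" by (auto simp: eventually_at_right_field)
    with first_neg_approx[OF f(3)] pos show False
      by (metis less_asym order_le_less)
  qed
  with f(4) t0 show pos: "0 < ?t" by (cases "?t = 0") auto
  with f(1) obtain l where l: "(f \<longlongrightarrow> l) (at_left ?t)" by (auto simp: cadlag_def)
  have "0 \<le> l"
  proof (rule tendsto_lowerbound[OF l])
    show "\<forall>\<^sub>F t in at_left ?t. 0 \<le> f t"
      unfolding eventually_at_left_field using pos
      by (intro exI[of _ 0]) (auto intro: before_first_neg)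
  qed auto
  moreover have "l \<le> f ?t" using f(2) l pos by (auto simp: no_negative_jumps_def)
  ultimately show "f ?t = 0" using le by simp
qed

section \<open>Passage time and area of sampled paths\<close>

definition area_to_neg :: "real \<Rightarrow> (real \<Rightarrow> real) \<Rightarrow> real" where
  "area_to_neg a f = (LINT t:{a<..<first_neg f}|lborel. f t)"

definition walk :: "real \<Rightarrow> (nat \<Rightarrow> real) \<Rightarrow> nat \<Rightarrow> real" where
  "walk x D k = x + (\<Sum>i<k. D i)"

definition walk_neg :: "real \<Rightarrow> (nat \<Rightarrow> real) \<Rightarrow> bool" where
  "walk_neg x D \<longleftrightarrow> (\<exists>k. walk x D k < 0)"

definition walk_time :: "real \<Rightarrow> (nat \<Rightarrow> real) \<Rightarrow> nat" where
  "walk_time x D = (LEAST k. walk x D k < 0)"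

text \<open>Right end points, since the paths are continuous from the right: the corresponding step
  functions then converge at every time.\<close>

definition walk_area :: "real \<Rightarrow> (nat \<Rightarrow> real) \<Rightarrow> real" where
  "walk_area x D = (\<Sum>k<walk_time x D. walk x D (Suc k))"

text \<open>A bounded continuous \<open>G\<close> survives limits under the expectation, and the
  constant 1 yields the probability of passage. Absence of passage counts as 0, which keeps the
  bound of \<open>G\<close> and cancels the meaningless \<open>walk_time\<close> in
  products.\<close>

definition walk_fun :: "real \<Rightarrow> real \<Rightarrow> (real \<times> real \<Rightarrow> complex) \<Rightarrow> (nat \<Rightarrow> real) \<Rightarrow> complex" where
  "walk_fun x h G D =
     (if walk_neg x D then G (h * real (walk_time x D), h * walk_area x D) else 0)"

definition path_fun :: "real \<Rightarrow> (real \<times> real \<Rightarrow> complex) \<Rightarrow> (real \<Rightarrow> real) \<Rightarrow> complex" where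
  "path_fun a G f = (if goes_neg f then G (first_neg f - a, area_to_neg a f) else 0)"

definition steps :: "real \<Rightarrow> real \<Rightarrow> (real \<Rightarrow> real) \<Rightarrow> nat \<Rightarrow> real" where
  "steps a h f i = f (a + h * real (Suc i)) - f (a + h * real i)"

lemma walk_steps: "walk x (steps a h f) k = f (a + h * real k) - (f a - x)"
  by (induction k) (auto simp: walk_def steps_def)

text \<open>The walk starts from \<open>f a\<close> but samples the path from the later time
  \<open>a' n\<close>, where the path is no higher. So it lies above the path by the gap
  \<open>- e n\<close>, which tends to 0 by right continuity. It cannot become negative before the
  path does, and it follows soon after once the gap is small.\<close>

lemma walk_passage:
  assumes f: "cadlag f" and a: "0 \<le> a" "\<And>n. a \<le> a' n" "a' \<longlonglongrightarrow> a"
    and h: "\<And>n. 0 < h n" "h \<longlonglongrightarrow> 0"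
    and x: "0 < f a" "\<And>n. f (a' n) \<le> f a"
    and neg: "goes_neg f" and before: "\<And>t. 0 \<le> t \<Longrightarrow> t \<le> a \<Longrightarrow> 0 \<le> f t"
  defines "D \<equiv> \<lambda>n. steps (a' n) (h n) f"
  shows "eventually (\<lambda>n. walk_neg (f a) (D n)) sequentially"
    and "(\<lambda>n. h n * real (walk_time (f a) (D n))) \<longlonglongrightarrow> first_neg f - a"
    and "(\<lambda>n. h n * walk_area (f a) (D n)) \<longlonglongrightarrow> area_to_neg a f"
    and "set_integrable lborel {a<..<first_neg f} f"
proof -
  let ?T = "first_neg f"
  define e where "e n = f (a' n) - f a" for n
  have W: "walk (f a) (D n) k = f (a' n + h n * real k) - e n" for n k
    by (simp add: D_def walk_steps e_def)
  have e_neg: "e n \<le> 0" for n using x(2) by (simp add: e_def)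
  have fa': "(\<lambda>n. f (a' n)) \<longlonglongrightarrow> f a" by (rule cadlag_right_seq[OF f a])
  then have e_lim: "e \<longlonglongrightarrow> 0" unfolding e_def by (rule LIM_zero)
  have aT: "a \<le> ?T"
    using before by (intro first_neg_ge[OF neg]) (meson not_le less_imp_le)
  have lower: "?T \<le> a' n + h n * real k" if "walk (f a) (D n) k < 0" for n k
    using that e_neg[of n] a(1) a(2)[of n] h(1)[of n] unfolding W
    by (intro first_neg_le) (auto intro!: add_nonneg_nonneg mult_nonneg_nonneg intro: less_imp_le)
  have upper: "eventually (\<lambda>n. \<exists>k. walk (f a) (D n) k < 0 \<and> a' n + h n * real k < u) sequentially"
    if "?T < u" for u
  proof -
    from first_neg_approx[OF neg that] obtain t where t: "0 \<le> t" "?T \<le> t" "t < u" "f t < 0" .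
    \<comment> \<open>The start is positive, so the negative value occurs strictly later; this
      leaves room for \<open>a' n\<close> to be below \<open>t\<close> eventually.\<close>
    have "a < t"
      using t aT x(1) by (cases "a = t") auto
    have "(f \<longlongrightarrow> f t) (at_right t)" using f t by (auto simp: cadlag_def)
    moreover have "f t < f t / 2" using t(4) by simp
    ultimately have "eventually (\<lambda>s. f s < f t / 2) (at_right t)" by (rule order_tendstoD)
    then obtain v where v: "v > t" "\<And>s. t < s \<Longrightarrow> s < v \<Longrightarrow> f s < f t / 2"
      by (auto simp: eventually_at_right_field)
    define w where "w = min u v"
    have w: "t < w" using v t by (auto simp: w_def)
    have "eventually (\<lambda>n. f t / 2 < e n) sequentially"
      using t(4) by (intro order_tendstoD[OF e_lim]) auto
    moreover have "eventually (\<lambda>n. h n < w - t) sequentially"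
      using w by (intro order_tendstoD[OF h(2)]) auto
    moreover have "eventually (\<lambda>n. a' n < t) sequentially"
      using \<open>a < t\<close> by (intro order_tendstoD[OF a(3)]) auto
    ultimately show ?thesis
    proof eventually_elim
      case (elim n)
      \<comment> \<open>The first grid index strictly after \<open>t\<close>, whether or not
        \<open>t\<close> is a grid point: the bound \<open>f t / 2\<close> is only known to the
        right of \<open>t\<close>.\<close>
      define k where "k = nat (\<lfloor>(t - a' n) / h n\<rfloor> + 1)"
      have "0 \<le> (t - a' n) / h n" using elim h(1)[of n] by simp
      then have "real k = of_int \<lfloor>(t - a' n) / h n\<rfloor> + 1" by (simp add: k_def)
      then have "(t - a' n) / h n < real k" "real k \<le> (t - a' n) / h n + 1" by linarith+
      then have k: "t < a' n + h n * real k" "a' n + h n * real k \<le> t + h n"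
        using h(1)[of n] by (auto simp: field_simps)
      then have "a' n + h n * real k < w" using elim by linarith
      then have "f (a' n + h n * real k) < f t / 2" "a' n + h n * real k < u"
        using v(2)[OF k(1)] by (auto simp: w_def)
      then show ?case using elim by (intro exI[of _ k]) (auto simp: W)
    qed
  qed
  show ev: "eventually (\<lambda>n. walk_neg (f a) (D n)) sequentially"
    using upper[of "?T + 1"] by (auto simp: walk_neg_def elim: eventually_mono)
  have lim: "(\<lambda>n. a' n + h n * real (walk_time (f a) (D n))) \<longlonglongrightarrow> ?T"
  proof (rule order_tendstoI)
    fix u assume u: "u < ?T"
    show "\<forall>\<^sub>F n in sequentially. u < a' n + h n * real (walk_time (f a) (D n))"
      using ev
    proof eventually_elim
      case (elim n)
      then have "walk (f a) (D n) (walk_time (f a) (D n)) < 0"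
        unfolding walk_neg_def walk_time_def by (rule LeastI_ex)
      then show ?case using lower u by fastforce
    qed
  next
    fix u assume "?T < u"
    from upper[OF this]
    show "\<forall>\<^sub>F n in sequentially. a' n + h n * real (walk_time (f a) (D n)) < u"
    proof eventually_elim
      case (elim n)
      then obtain k where k: "walk (f a) (D n) k < 0" "a' n + h n * real k < u" by blast
      have "walk_time (f a) (D n) \<le> k" unfolding walk_time_def by (rule Least_le) (rule k(1))
      then have "h n * real (walk_time (f a) (D n)) \<le> h n * real k"
        using h(1)[of n] by (intro mult_left_mono) auto
      then show ?case using k by linarith
    qed
  qed
  show time: "(\<lambda>n. h n * real (walk_time (f a) (D n))) \<longlonglongrightarrow> ?T - a"
    using tendsto_diff[OF lim a(3)] by simp
  show "set_integrable lborel {a<..<first_neg f} f"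
    by (rule right_riemann_sum_tendsto(1)[OF f a h lim])
  \<comment> \<open>The gap contributes itself times the elapsed time; the time converges and the
    gap tends to 0.\<close>
  have sums: "h n * walk_area (f a) (D n) =
      h n * (\<Sum>k<walk_time (f a) (D n). f (a' n + h n * real (Suc k)))
      - e n * (h n * real (walk_time (f a) (D n)))" for n
    by (simp add: walk_area_def W sum_subtractf algebra_simps del: of_nat_Suc)
  show "(\<lambda>n. h n * walk_area (f a) (D n)) \<longlonglongrightarrow> area_to_neg a f"
    unfolding sums area_to_neg_def
    using tendsto_diff[OF right_riemann_sum_tendsto(2)[OF f a h lim] tendsto_mult[OF e_lim time]]
    by simp
qed

text \<open>If the path never goes negative, neither does the walk above it, and the default value 0
  agrees on both sides. Otherwise passage time and area converge and \<open>G\<close> is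
  continuous.\<close>

lemma walk_fun_tendsto:
  assumes f: "cadlag f" and a: "0 \<le> a" "\<And>n. a \<le> a' n" "a' \<longlonglongrightarrow> a"
    and h: "\<And>n. 0 < h n" "h \<longlonglongrightarrow> 0"
    and x: "0 < f a" "\<And>n. f (a' n) \<le> f a"
    and before: "\<And>t. 0 \<le> t \<Longrightarrow> t \<le> a \<Longrightarrow> 0 \<le> f t"
    and G: "continuous_on UNIV G"
  shows "(\<lambda>n. walk_fun (f a) (h n) G (steps (a' n) (h n) f)) \<longlonglongrightarrow> path_fun a G f"
proof (cases "goes_neg f")
  case True
  note P = walk_passage[OF f a h x True before]
  have "(\<lambda>n. G (h n * real (walk_time (f a) (steps (a' n) (h n) f)),
      h n * walk_area (f a) (steps (a' n) (h n) f))) \<longlonglongrightarrow> G (first_neg f - a, area_to_neg a f)"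
    by (rule continuous_on_tendsto_compose[OF G]) (auto intro!: tendsto_Pair P)
  with True P(1) show ?thesis
    unfolding path_fun_def walk_fun_def
    by (auto elim!: Lim_transform_eventually elim: eventually_mono)
next
  case False
  have "\<not> walk_neg (f a) (steps (a' n) (h n) f)" for n
  proof
    assume "walk_neg (f a) (steps (a' n) (h n) f)"
    then obtain k where "f (a' n + h n * real k) - (f (a' n) - f a) < 0"
      by (auto simp: walk_neg_def walk_steps)
    moreover have "0 \<le> a' n + h n * real k" using a(1) a(2)[of n] h(1)[of n]
      by (auto intro!: add_nonneg_nonneg mult_nonneg_nonneg intro: less_imp_le)
    ultimately show False using False x(2)[of n] by (force simp: goes_neg_def)
  qed
  with False show ?thesis by (simp add: path_fun_def walk_fun_def)
qed

subsection \<open>Strong Markov property of random walks\<close>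

abbreviation seq_borel :: "(nat \<Rightarrow> real) measure" where
  "seq_borel \<equiv> Pi\<^sub>M UNIV (\<lambda>_. borel)"

lemma measurable_walk[measurable]: "(\<lambda>D. walk x D k) \<in> borel_measurable seq_borel"
  unfolding walk_def by measurable

lemma measurable_walk_neg[measurable]: "Measurable.pred seq_borel (walk_neg x)"
  unfolding walk_neg_def by measurable

lemma measurable_walk_time[measurable]: "walk_time x \<in> measurable seq_borel (count_space UNIV)"
  unfolding walk_time_def by measurable

lemma measurable_walk_area[measurable]: "walk_area x \<in> borel_measurable seq_borel"
  unfolding walk_area_def
  by (rule measurable_compose_countable[where f="\<lambda>n D. \<Sum>k<n. walk x D (Suc k)"]) measurable

lemma measurable_walk_fun[measurable]:
  assumes "continuous_on UNIV G"
  shows "walk_fun x h G \<in> borel_measurable seq_borel"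
proof -
  have [measurable]: "G \<in> borel_measurable (borel \<Otimes>\<^sub>M borel)"
    using borel_measurable_continuous_onI[OF assms] by (simp add: borel_prod)
  show ?thesis unfolding walk_fun_def by measurable
qed

lemma norm_walk_fun_le: "(\<And>z. norm (G z) \<le> 1) \<Longrightarrow> norm (walk_fun x h G D) \<le> 1"
  by (simp add: walk_fun_def)

text \<open>A positive factor changes no sign, hence not the index of passage. The mesh contributes
  \<open>r\<close> to time and area alike, and the height adds a factor \<open>c\<close> to the
  area.\<close>

lemma walk_fun_scale:
  assumes "0 < c" "h = r * h'"
  shows "walk_fun c h G (\<lambda>i. c * D i) = walk_fun 1 h' (\<lambda>(s, a). G (r * s, c * r * a)) D"
proof -
  have w: "walk c (\<lambda>i. c * D i) k = c * walk 1 D k" for k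
    by (simp add: walk_def sum_distrib_left distrib_left)
  have lt: "walk c (\<lambda>i. c * D i) k < 0 \<longleftrightarrow> walk 1 D k < 0" for k
    using assms(1) by (simp add: w mult_less_0_iff)
  have neg: "walk_neg c (\<lambda>i. c * D i) \<longleftrightarrow> walk_neg 1 D"
    by (simp only: walk_neg_def lt)
  have time: "walk_time c (\<lambda>i. c * D i) = walk_time 1 D"
    by (simp only: walk_time_def lt)
  have area: "walk_area c (\<lambda>i. c * D i) = c * walk_area 1 D"
    by (simp add: walk_area_def time w sum_distrib_left)
  show ?thesis
    by (simp add: walk_fun_def neg time area assms(2) mult.assoc mult.left_commute)
qed

text \<open>Removes the least number operator, so that passage at step \<open>k\<close> is visibly
  an event of the first \<open>k\<close> steps.\<close>

lemma walk_time_eq_iff: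
  "walk_neg x D \<and> walk_time x D = k \<longleftrightarrow> walk x D k < 0 \<and> (\<forall>j<k. \<not> walk x D j < 0)"
proof (intro iffI conjI allI impI)
  assume "walk_neg x D \<and> walk_time x D = k"
  then have ex: "\<exists>j. walk x D j < 0" and k: "k = (LEAST j. walk x D j < 0)"
    by (simp_all add: walk_neg_def walk_time_def)
  show "walk x D k < 0" unfolding k by (rule LeastI_ex[OF ex])
  show "\<not> walk x D j < 0" if "j < k" for j
    using that unfolding k by (rule not_less_Least)
next
  assume k: "walk x D k < 0 \<and> (\<forall>j<k. \<not> walk x D j < 0)"
  then show "walk_neg x D" by (auto simp: walk_neg_def)
  show "walk_time x D = k"
    unfolding walk_time_def using k by (intro Least_equality) (auto simp: not_less[symmetric])
qed

text \<open>Decomposition over the index \<open>k\<close> of the passage. For fixed \<open>k\<close>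
  the first factor involves the first \<open>k\<close> steps only and the second one the later
  steps, and an infinite product measure is invariant under replacing the later steps by an
  independent copy.\<close>

lemma walk_strong_markov:
  fixes \<nu> :: "real measure" and H :: "(nat \<Rightarrow> real) \<Rightarrow> complex"
  assumes \<nu>: "prob_space \<nu>" "sets \<nu> = sets borel"
    and G: "continuous_on UNIV G" "\<And>z. norm (G z) \<le> 1"
    and H: "H \<in> borel_measurable seq_borel" "\<And>D. norm (H D) \<le> 1"
  defines "S \<equiv> Pi\<^sub>M UNIV (\<lambda>_. \<nu>)"
  shows "(\<integral>D. walk_fun x h G D * H (\<lambda>i. D (walk_time x D + i)) \<partial>S)
    = (\<integral>D. walk_fun x h G D \<partial>S) * (\<integral>D. H D \<partial>S)"
proof -
  interpret \<nu>: prob_space \<nu> by fact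
  interpret sequence_space \<nu> ..
  have S: "sets S = sets seq_borel" unfolding S_def by (intro sets_PiM_cong refl \<nu>)
  note [measurable_cong] = S
  interpret S: prob_space S unfolding S_def by (rule P.prob_space_axioms)
  interpret Q: pair_prob_space S S ..
  note [measurable] = H(1) G(1)
  define F where "F k D = (if walk x D k < 0 \<and> (\<forall>j<k. \<not> walk x D j < 0)
      then G (h * real k, h * (\<Sum>j<k. walk x D (Suc j))) else 0)" for k D
  have F_eq: "F k D = (if walk_neg x D \<and> walk_time x D = k then walk_fun x h G D else 0)" for k D
    unfolding F_def walk_time_eq_iff[symmetric] by (auto simp: walk_fun_def walk_area_def)
  have [measurable]: "F k \<in> borel_measurable seq_borel" for k
    unfolding F_eq by measurable
  have shift[measurable]: "(\<lambda>D i. D (k + i)) \<in> measurable seq_borel seq_borel" for k :: nat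
    by (rule measurable_PiM_single') auto
  have stop_shift[measurable]: "(\<lambda>D. H (\<lambda>i. D (walk_time x D + i))) \<in> borel_measurable seq_borel"
    by (rule measurable_compose_countable[where f="\<lambda>k D. H (\<lambda>i. D (k + i))"]) measurable
  have F1: "norm (F k D) \<le> 1" for k D using G(2) by (simp add: F_def)
  have intF: "integrable S (F k)" for k
    by (rule S.integrable_const_bound[where B=1]) (use F1 in auto)
  have intFH: "integrable S (\<lambda>D. F k D * H (\<lambda>i. D (k + i)))" for k
    by (rule S.integrable_const_bound[where B=1])
       (use F1 H(2) in \<open>auto simp: norm_mult intro!: mult_le_one\<close>)
  have step: "(\<integral>D. F k D * H (\<lambda>i. D (k + i)) \<partial>S) = (\<integral>D. F k D \<partial>S) * (\<integral>D. H D \<partial>S)" for k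
  proof -
    \<comment> \<open>\<open>comb_seq\<close> takes its first \<open>k\<close> entries from one
      sequence and all later ones from another; \<open>F k\<close> sees only the former, the shift
      only the latter.\<close>
    have comb: "F k (comb_seq k \<omega> \<omega>') = F k \<omega>" "(\<lambda>i. comb_seq k \<omega> \<omega>' (k + i)) = \<omega>'" for \<omega> \<omega>'
    proof -
      have "walk x (comb_seq k \<omega> \<omega>') j = walk x \<omega> j" if "j \<le> k" for j
        using that by (simp add: walk_def comb_seq_less)
      then show "F k (comb_seq k \<omega> \<omega>') = F k \<omega>" by (simp add: F_def cong: conj_cong)
      show "(\<lambda>i. comb_seq k \<omega> \<omega>' (k + i)) = \<omega>'"
        using comb_seq_add[of k \<omega> \<omega>'] by (simp add: add.commute)
    qed
    have "(\<integral>D. F k D * H (\<lambda>i. D (k + i)) \<partial>S)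
        = (\<integral>D. F k D * H (\<lambda>i. D (k + i)) \<partial>distr (S \<Otimes>\<^sub>M S) S (\<lambda>(\<omega>, \<omega>'). comb_seq k \<omega> \<omega>'))"
      using PiM_comb_seq[of k] by (simp add: S_def)
    also have "\<dots> = (\<integral>z. F k (fst z) * H (snd z) \<partial>(S \<Otimes>\<^sub>M S))"
      by (subst integral_distr)
         (auto simp: S_def comb split_beta intro: measurable_comb_seq simp flip: S_def)
    also have "\<dots> = (\<integral>\<omega>. \<integral>\<omega>'. F k \<omega> * H \<omega>' \<partial>S \<partial>S)"
    proof (subst Q.integral_fst'[symmetric])
      show "integrable (S \<Otimes>\<^sub>M S) (\<lambda>z. F k (fst z) * H (snd z))"
        by (rule Q.integrable_const_bound[where B=1])
           (use F1 H(2) in \<open>auto simp: norm_mult intro!: mult_le_one\<close>)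
    qed simp
    finally show ?thesis by simp
  qed
  \<comment> \<open>At most one summand is nonzero, so the partial sums stay bounded by 1 and are
    eventually constant in \<open>n\<close>.\<close>
  have sum_F: "(\<Sum>k<n. F k D) = (if walk_neg x D \<and> walk_time x D < n then walk_fun x h G D else 0)"
    for n D
    unfolding F_eq by (auto simp: if_distrib sum.delta)
  have sum_FH: "(\<Sum>k<n. F k D * H (\<lambda>i. D (k + i))) = (if walk_neg x D \<and> walk_time x D < n
      then walk_fun x h G D * H (\<lambda>i. D (walk_time x D + i)) else 0)" for n D
  proof -
    have "(\<Sum>k<n. F k D * H (\<lambda>i. D (k + i))) = (\<Sum>k<n. F k D) * H (\<lambda>i. D (walk_time x D + i))"
      unfolding sum_distrib_right by (rule sum.cong) (auto simp: F_eq)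
    then show ?thesis by (simp add: sum_F)
  qed
  have wf1: "norm (walk_fun x h G D) \<le> 1" for D by (rule norm_walk_fun_le[OF G(2)])
  have lim: "(\<lambda>n. if walk_neg x D \<and> walk_time x D < n then z else 0) \<longlonglongrightarrow> (if walk_neg x D then z else 0)"
    for D and z :: complex
    by (rule tendsto_eventually, rule eventually_mono[OF eventually_gt_at_top[of "walk_time x D"]]) auto
  have "(\<lambda>n. \<integral>D. (\<Sum>k<n. F k D) \<partial>S) \<longlonglongrightarrow> (\<integral>D. walk_fun x h G D \<partial>S)"
  proof (rule integral_dominated_convergence[where w="\<lambda>_. 1"])
    show "AE D in S. (\<lambda>n. \<Sum>k<n. F k D) \<longlonglongrightarrow> walk_fun x h G D"
    proof (intro always_eventually allI)
      fix D
      show "(\<lambda>n. \<Sum>k<n. F k D) \<longlonglongrightarrow> walk_fun x h G D"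
        unfolding sum_F using lim[of D "walk_fun x h G D"]
        by (cases "walk_neg x D") (auto simp: walk_fun_def)
    qed
    show "AE D in S. norm (\<Sum>k<n. F k D) \<le> 1" for n
      using wf1 by (auto simp: sum_F)
  qed auto
  then have "(\<lambda>n. (\<integral>D. (\<Sum>k<n. F k D) \<partial>S) * (\<integral>D. H D \<partial>S))
      \<longlonglongrightarrow> (\<integral>D. walk_fun x h G D \<partial>S) * (\<integral>D. H D \<partial>S)"
    by (intro tendsto_intros)
  moreover have "(\<integral>D. (\<Sum>k<n. F k D) \<partial>S) * (\<integral>D. H D \<partial>S)
      = (\<integral>D. (\<Sum>k<n. F k D * H (\<lambda>i. D (k + i))) \<partial>S)" for n
    using intF intFH by (simp add: sum_distrib_right step)
  moreover have "(\<lambda>n. \<integral>D. (\<Sum>k<n. F k D * H (\<lambda>i. D (k + i))) \<partial>S)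
      \<longlonglongrightarrow> (\<integral>D. walk_fun x h G D * H (\<lambda>i. D (walk_time x D + i)) \<partial>S)"
  proof (rule integral_dominated_convergence[where w="\<lambda>_. 1"])
    show "AE D in S. (\<lambda>n. \<Sum>k<n. F k D * H (\<lambda>i. D (k + i)))
        \<longlonglongrightarrow> walk_fun x h G D * H (\<lambda>i. D (walk_time x D + i))"
    proof (intro always_eventually allI)
      fix D
      show "(\<lambda>n. \<Sum>k<n. F k D * H (\<lambda>i. D (k + i)))
        \<longlonglongrightarrow> walk_fun x h G D * H (\<lambda>i. D (walk_time x D + i))"
        unfolding sum_FH using lim[of D "walk_fun x h G D * H (\<lambda>i. D (walk_time x D + i))"]
        by (cases "walk_neg x D") (auto simp: walk_fun_def)
    qed
    show "AE D in S. norm (\<Sum>k<n. F k D * H (\<lambda>i. D (k + i))) \<le> 1" for n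
      using wf1 H(2) by (auto simp: sum_FH norm_mult intro!: mult_le_one)
  qed auto
  ultimately show ?thesis by (simp add: LIMSEQ_unique)
qed

subsection \<open>Strong Markov property and scaling of stable paths\<close>

lemma cadlag_add_const:
  assumes "cadlag f"
  shows "cadlag (\<lambda>t. f t + c)"
  unfolding cadlag_def
proof (intro conjI allI impI)
  fix t :: real
  show "((\<lambda>t. f t + c) \<longlongrightarrow> f t + c) (at_right t)" if "0 \<le> t"
    using assms that by (intro tendsto_add tendsto_const) (simp add: cadlag_def)
  assume "0 < t"
  with assms obtain l where "(f \<longlongrightarrow> l) (at_left t)" by (auto simp: cadlag_def)
  then have "((\<lambda>t. f t + c) \<longlongrightarrow> l + c) (at_left t)" by (intro tendsto_add tendsto_const)
  then show "\<exists>l. ((\<lambda>t. f t + c) \<longlongrightarrow> l) (at_left t)" by blast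
qed

lemma no_negative_jumps_add_const:
  assumes "no_negative_jumps f"
  shows "no_negative_jumps (\<lambda>t. f t + c)"
  unfolding no_negative_jumps_def
proof (intro allI impI)
  fix t l :: real
  assume "0 < t" "((\<lambda>t. f t + c) \<longlongrightarrow> l) (at_left t)"
  then have "(f \<longlongrightarrow> l - c) (at_left t)"
    using tendsto_diff[of "\<lambda>t. f t + c" l _ "\<lambda>_. c" c] by simp
  with assms \<open>0 < t\<close> have "l - c \<le> f t" by (auto simp: no_negative_jumps_def)
  then show "l \<le> f t + c" by simp
qed

lemma reciprocal_Suc_seq: "0 < 1 / real (Suc n)" "(\<lambda>n. 1 / real (Suc n)) \<longlonglongrightarrow> 0"
  using LIMSEQ_inverse_real_of_nat unfolding inverse_eq_divide by simp_all

text \<open>Walks see the process only through its steps on grids, so the laws are assumed in that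
  form: \<open>law\<close> makes the steps independent and identically distributed,
  \<open>scale\<close> is self-similarity of whole step sequences. \<open>neg\<close> is what the
  Laplace transform contributes; it rules out constant paths, which never pass.\<close>

locale stable_paths = prob_space M for M :: "'w measure" +
  fixes L :: "real \<Rightarrow> 'w \<Rightarrow> real" and \<alpha> :: real
  assumes \<alpha>: "0 < \<alpha>"
    and meas: "\<And>t. 0 \<le> t \<Longrightarrow> L t \<in> borel_measurable M"
    and start: "\<And>\<omega>. \<omega> \<in> space M \<Longrightarrow> L 0 \<omega> = 1"
    and cadlag: "\<And>\<omega>. \<omega> \<in> space M \<Longrightarrow> cadlag (\<lambda>t. L t \<omega>)"
    and no_neg: "\<And>\<omega>. \<omega> \<in> space M \<Longrightarrow> no_negative_jumps (\<lambda>t. L t \<omega>)"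
    and law: "\<And>h. 0 < h \<Longrightarrow> distr M seq_borel (\<lambda>\<omega>. steps 0 h (\<lambda>t. L t \<omega>))
        = Pi\<^sub>M UNIV (\<lambda>_. distr M borel (\<lambda>\<omega>. L h \<omega> - 1))"
    and scale: "\<And>c h. 0 < c \<Longrightarrow> 0 < h \<Longrightarrow>
        distr M seq_borel (\<lambda>\<omega>. steps 0 (c powr \<alpha> * h) (\<lambda>t. L t \<omega>))
        = distr M seq_borel (\<lambda>\<omega> i. c * steps 0 h (\<lambda>t. L t \<omega>) i)"
    and neg: "\<not> (AE \<omega> in M. 1 \<le> L 1 \<omega>)"
begin

text \<open>One space serves all starting levels. A translation keeps the steps, and the path passes
  below \<open>c\<close> exactly when \<open>path_from (1 - c)\<close> passes below zero.\<close>

abbreviation path_from :: "real \<Rightarrow> 'w \<Rightarrow> real \<Rightarrow> real" where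
  "path_from x \<omega> \<equiv> \<lambda>t. L t \<omega> + (x - 1)"

lemma path_good:
  assumes "\<omega> \<in> space M"
  shows "cadlag (path_from x \<omega>)" "no_negative_jumps (path_from x \<omega>)" "path_from x \<omega> 0 = x"
  by (rule cadlag_add_const[OF cadlag[OF assms]],
      rule no_negative_jumps_add_const[OF no_neg[OF assms]], simp add: start[OF assms])

lemma steps_path: "steps a h (path_from x \<omega>) = steps a h (\<lambda>t. L t \<omega>)"
  by (simp add: steps_def fun_eq_iff)

lemma measurable_steps[measurable]:
  assumes "0 < h"
  shows "(\<lambda>\<omega>. steps 0 h (\<lambda>t. L t \<omega>)) \<in> measurable M seq_borel"
proof (rule measurable_PiM_single')
  fix i
  have [measurable]: "L (0 + h * real (Suc i)) \<in> borel_measurable M"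
      "L (0 + h * real i) \<in> borel_measurable M"
    using assms by (intro meas; simp)+
  show "(\<lambda>\<omega>. steps 0 h (\<lambda>t. L t \<omega>) i) \<in> borel_measurable M"
    unfolding steps_def by measurable
qed simp

lemma path_fun_tendsto:
  assumes "0 < x" "\<And>n. 0 < h n" "h \<longlonglongrightarrow> 0" "continuous_on UNIV G" "\<omega> \<in> space M"
  shows "(\<lambda>n. walk_fun x (h n) G (steps 0 (h n) (\<lambda>t. L t \<omega>))) \<longlonglongrightarrow> path_fun 0 G (path_from x \<omega>)"
proof -
  note P = path_good[OF assms(5), of x]
  have "(\<lambda>n. walk_fun (path_from x \<omega> 0) (h n) G (steps 0 (h n) (path_from x \<omega>))) \<longlonglongrightarrow> path_fun 0 G (path_from x \<omega>)"
  proof (rule walk_fun_tendsto[OF P(1) _ _ _ assms(2,3) _ _ _ assms(4)])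
    fix t :: real assume "0 \<le> t" "t \<le> 0"
    then have "t = 0" by simp
    then show "0 \<le> path_from x \<omega> t" using P(3) assms(1) by simp
  qed (use P(3) assms(1) in simp_all)
  then show ?thesis using P(3) by (simp only: steps_path)
qed

text \<open>The passage time is an infimum over uncountably many times; its functionals inherit
  measurability as limits of walk functionals.\<close>

lemma borel_measurable_path_fun[measurable]:
  assumes "0 < x" "continuous_on UNIV G"
  shows "(\<lambda>\<omega>. path_fun 0 G (path_from x \<omega>)) \<in> borel_measurable M"
proof (rule borel_measurable_LIMSEQ_metric)
  let ?h = "\<lambda>n. 1 / real (Suc n)"
  show "(\<lambda>\<omega>. walk_fun x (?h n) G (steps 0 (?h n) (\<lambda>t. L t \<omega>))) \<in> borel_measurable M" for n
    by (rule measurable_compose[OF measurable_steps measurable_walk_fun[OF assms(2)]]) simp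
  show "(\<lambda>n. walk_fun x (?h n) G (steps 0 (?h n) (\<lambda>t. L t \<omega>))) \<longlonglongrightarrow> path_fun 0 G (path_from x \<omega>)"
    if "\<omega> \<in> space M" for \<omega>
    by (rule path_fun_tendsto[OF assms(1) reciprocal_Suc_seq assms(2) that])
qed

lemma expectation_walk_fun_tendsto:
  assumes "0 < x" "\<And>n. 0 < h n" "h \<longlonglongrightarrow> 0" "continuous_on UNIV G" "\<And>z. norm (G z) \<le> 1"
  shows "(\<lambda>n. \<integral>\<omega>. walk_fun x (h n) G (steps 0 (h n) (\<lambda>t. L t \<omega>)) \<partial>M)
    \<longlonglongrightarrow> (\<integral>\<omega>. path_fun 0 G (path_from x \<omega>) \<partial>M)"
proof (rule integral_dominated_convergence[where w="\<lambda>_. 1"])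
  show "(\<lambda>\<omega>. path_fun 0 G (path_from x \<omega>)) \<in> borel_measurable M" using assms by measurable
  show "(\<lambda>\<omega>. walk_fun x (h n) G (steps 0 (h n) (\<lambda>t. L t \<omega>))) \<in> borel_measurable M" for n
    by (rule measurable_compose[OF measurable_steps measurable_walk_fun[OF assms(4)]]) (rule assms)
  show "AE \<omega> in M. (\<lambda>n. walk_fun x (h n) G (steps 0 (h n) (\<lambda>t. L t \<omega>))) \<longlonglongrightarrow> path_fun 0 G (path_from x \<omega>)"
    using assms by (intro AE_I2 path_fun_tendsto)
qed (use assms in \<open>auto intro!: AE_I2 norm_walk_fun_le\<close>)

text \<open>Level \<open>c\<close> on mesh \<open>c powr \<alpha> * h\<close> and level 1 on mesh
  \<open>h\<close> give walks that agree in law up to the factor \<open>c\<close>. The two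
  expectations thus coincide for every mesh, before any limit is taken.\<close>

lemma path_fun_scale:
  assumes c: "0 < c" and G: "continuous_on UNIV G" "\<And>z. norm (G z) \<le> 1"
  shows "(\<integral>\<omega>. path_fun 0 G (path_from c \<omega>) \<partial>M)
    = (\<integral>\<omega>. path_fun 0 (\<lambda>(s, a). G (c powr \<alpha> * s, c powr (\<alpha> + 1) * a)) (path_from 1 \<omega>) \<partial>M)"
proof -
  let ?G = "\<lambda>(s, a). G (c powr \<alpha> * s, c * c powr \<alpha> * a)"
  let ?h = "\<lambda>n. 1 / real (Suc n)"
  let ?h' = "\<lambda>n. c powr \<alpha> * (1 / real (Suc n))"
  have G': "continuous_on UNIV ?G"
    unfolding split_beta'
    by (rule continuous_on_compose2[OF G(1)]) (intro continuous_intros, simp)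
  have "(\<lambda>n. \<integral>\<omega>. walk_fun c (?h' n) G (steps 0 (?h' n) (\<lambda>t. L t \<omega>)) \<partial>M)
    \<longlonglongrightarrow> (\<integral>\<omega>. path_fun 0 G (path_from c \<omega>) \<partial>M)"
    using c tendsto_mult_left[OF reciprocal_Suc_seq(2), of "c powr \<alpha>"] G by (intro expectation_walk_fun_tendsto) auto
  moreover have "(\<lambda>n. \<integral>\<omega>. walk_fun 1 (?h n) ?G (steps 0 (?h n) (\<lambda>t. L t \<omega>)) \<partial>M)
    \<longlonglongrightarrow> (\<integral>\<omega>. path_fun 0 ?G (path_from 1 \<omega>) \<partial>M)"
    using reciprocal_Suc_seq G' G(2) by (intro expectation_walk_fun_tendsto) auto
  moreover have "(\<integral>\<omega>. walk_fun c (?h' n) G (steps 0 (?h' n) (\<lambda>t. L t \<omega>)) \<partial>M)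
    = (\<integral>\<omega>. walk_fun 1 (?h n) ?G (steps 0 (?h n) (\<lambda>t. L t \<omega>)) \<partial>M)" for n
  proof -
    have m: "(\<lambda>\<omega>. steps 0 (?h n) (\<lambda>t. L t \<omega>)) \<in> measurable M seq_borel"
      by (rule measurable_steps) simp
    have "(\<lambda>D i. c * D i) \<in> measurable seq_borel seq_borel"
      by (rule measurable_PiM_single') auto
    from measurable_compose[OF m this]
    have m2: "(\<lambda>\<omega> i. c * steps 0 (?h n) (\<lambda>t. L t \<omega>) i) \<in> measurable M seq_borel" .
    have "(\<integral>\<omega>. walk_fun c (?h' n) G (steps 0 (?h' n) (\<lambda>t. L t \<omega>)) \<partial>M)
      = (\<integral>D. walk_fun c (?h' n) G D \<partial>distr M seq_borel (\<lambda>\<omega>. steps 0 (?h' n) (\<lambda>t. L t \<omega>)))"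
      using c by (intro integral_distr[symmetric] measurable_walk_fun G measurable_steps) auto
    also have "\<dots> = (\<integral>D. walk_fun c (?h' n) G D \<partial>distr M seq_borel (\<lambda>\<omega> i. c * steps 0 (?h n) (\<lambda>t. L t \<omega>) i))"
      using c by (subst scale) auto
    also have "\<dots> = (\<integral>\<omega>. walk_fun c (?h' n) G (\<lambda>i. c * steps 0 (?h n) (\<lambda>t. L t \<omega>) i) \<partial>M)"
      by (rule integral_distr[OF m2 measurable_walk_fun[OF G(1)]])
    also have "\<dots> = (\<integral>\<omega>. walk_fun 1 (?h n) ?G (steps 0 (?h n) (\<lambda>t. L t \<omega>)) \<partial>M)"
      by (simp only: walk_fun_scale[OF c refl])
    finally show ?thesis .
  qed
  ultimately have "(\<integral>\<omega>. path_fun 0 G (path_from c \<omega>) \<partial>M) = (\<integral>\<omega>. path_fun 0 ?G (path_from 1 \<omega>) \<partial>M)"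
    using LIMSEQ_unique by simp
  moreover have "c * c powr \<alpha> = c powr (\<alpha> + 1)" using c by (simp add: powr_add)
  ultimately show ?thesis by simp
qed

text \<open>Both sides are limits of the identity for walks. The first factor reads the path until
  it passes below \<open>c\<close>, the second one reads it from then on, when it stands at
  \<open>c\<close> exactly.\<close>

lemma strong_markov:
  assumes c: "0 < c" "c < 1"
    and G: "continuous_on UNIV G" "\<And>z. norm (G z) \<le> 1"
    and H: "continuous_on UNIV H" "\<And>z. norm (H z) \<le> 1"
  shows "(\<lambda>\<omega>. path_fun 0 G (path_from (1 - c) \<omega>) *
      path_fun (first_neg (path_from (1 - c) \<omega>)) H (path_from 1 \<omega>)) \<in> borel_measurable M"
    and "(\<integral>\<omega>. path_fun 0 G (path_from (1 - c) \<omega>) *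
      path_fun (first_neg (path_from (1 - c) \<omega>)) H (path_from 1 \<omega>) \<partial>M)
    = (\<integral>\<omega>. path_fun 0 G (path_from (1 - c) \<omega>) \<partial>M) * (\<integral>\<omega>. path_fun 0 H (path_from c \<omega>) \<partial>M)"
proof -
  let ?h = "\<lambda>n. 1 / real (Suc n)"
  let ?D = "\<lambda>n \<omega>. steps 0 (?h n) (\<lambda>t. L t \<omega>)"
  define F where "F n D = walk_fun (1 - c) (?h n) G D *
      walk_fun c (?h n) H (\<lambda>i. D (walk_time (1 - c) D + i))" for n D
  let ?P = "\<lambda>\<omega>. path_fun 0 G (path_from (1 - c) \<omega>) *
      path_fun (first_neg (path_from (1 - c) \<omega>)) H (path_from 1 \<omega>)"
  have y: "0 < 1 - c" using c by simp
  have mD: "?D n \<in> measurable M seq_borel" for n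
    by (rule measurable_steps) simp
  have mG[measurable]: "walk_fun x h G \<in> borel_measurable seq_borel" for x h
    by (rule measurable_walk_fun[OF G(1)])
  have mH[measurable]: "walk_fun x h H \<in> borel_measurable seq_borel" for x h
    by (rule measurable_walk_fun[OF H(1)])
  have shift[measurable]: "(\<lambda>D i. D (k + i)) \<in> measurable seq_borel seq_borel" for k :: nat
    by (rule measurable_PiM_single') auto
  have [measurable]: "(\<lambda>D. walk_fun c h H (\<lambda>i. D (walk_time (1 - c) D + i))) \<in> borel_measurable seq_borel" for h
    by (rule measurable_compose_countable[where f="\<lambda>k D. walk_fun c h H (\<lambda>i. D (k + i))"]) measurable
  have F_meas: "F n \<in> borel_measurable seq_borel" for n
    unfolding F_def by measurable
  have F_path_meas: "(\<lambda>\<omega>. F n (?D n \<omega>)) \<in> borel_measurable M" for n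
    by (rule measurable_compose[OF mD F_meas])
  have F_le: "norm (F n D) \<le> 1" for n D
    unfolding F_def norm_mult using norm_walk_fun_le[OF G(2)] norm_walk_fun_le[OF H(2)]
    by (intro mult_le_one) auto
  have lim: "(\<lambda>n. F n (?D n \<omega>)) \<longlonglongrightarrow> ?P \<omega>" if \<omega>: "\<omega> \<in> space M" for \<omega>
  proof -
    let ?f = "path_from 1 \<omega>" and ?g = "path_from (1 - c) \<omega>"
    note limG = path_fun_tendsto[OF y reciprocal_Suc_seq G(1) \<omega>]
    note gf = path_good[OF \<omega>, of 1] and gg = path_good[OF \<omega>, of "1 - c"]
    show ?thesis
    proof (cases "goes_neg ?g")
      \<comment> \<open>The second walk need not converge here; it is bounded, and the first factor
        tends to 0.\<close>
      case False
      then have 0: "path_fun 0 G ?g = 0" by (simp add: path_fun_def)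
      have "(\<lambda>n. F n (?D n \<omega>)) \<longlonglongrightarrow> 0"
      proof (rule Lim_null_comparison)
        show "(\<lambda>n. norm (walk_fun (1 - c) (?h n) G (?D n \<omega>))) \<longlonglongrightarrow> 0"
          using tendsto_norm[OF limG] 0 by simp
        show "\<forall>\<^sub>F n in sequentially. norm (F n (?D n \<omega>)) \<le> norm (walk_fun (1 - c) (?h n) G (?D n \<omega>))"
          unfolding F_def norm_mult using norm_walk_fun_le[OF H(2)]
          by (intro always_eventually allI mult_left_le) auto
      qed
      then show ?thesis using 0 by simp
    next
      case True
      define \<tau> where "\<tau> = first_neg ?g"
      have \<tau>: "0 < \<tau>" "?g \<tau> = 0"
        unfolding \<tau>_def using first_neg_eq_0[OF gg(1,2) True] gg(3) y by simp_all
      define a where "a n = ?h n * real (walk_time (1 - c) (?D n \<omega>))" for n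
      \<comment> \<open>The grid passage time, replaced by \<open>\<tau>\<close> for the finitely
        many \<open>n\<close> without passage, so that \<open>a' n\<close> is at least
        \<open>\<tau>\<close> and the path is at most \<open>c\<close> there for every
        \<open>n\<close>.\<close>
      define a' where "a' n = (if walk_neg (1 - c) (?D n \<omega>) then a n else \<tau>)" for n
      have before: "0 \<le> ?f t" if "0 \<le> t" "t \<le> \<tau>" for t
      proof (cases "t = \<tau>")
        case False
        then have "0 \<le> ?g t" using that before_first_neg[of t ?g] by (simp add: \<tau>_def)
        then show ?thesis using c by simp
      qed (use \<tau>(2) c in simp)
      have g0: "?g 0 = 1 - c" by (rule gg(3))
      have "walk_neg (1 - c) (?D n \<omega>) \<Longrightarrow> ?g (a n) < 0" for n
      proof -
        assume "walk_neg (1 - c) (?D n \<omega>)"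
        then have "walk (1 - c) (?D n \<omega>) (walk_time (1 - c) (?D n \<omega>)) < 0"
          unfolding walk_neg_def walk_time_def by (rule LeastI_ex)
        then show "?g (a n) < 0"
          using g0 by (simp add: walk_steps a_def start[OF \<omega>])
      qed
      then have a'_neg: "?f (a' n) \<le> c" "\<tau> \<le> a' n" for n
        using \<tau> first_neg_le[of "a n" ?g] by (force simp: a'_def \<tau>_def a_def)+
      have x0: "0 < ?g 0" using g0 y by simp
      have le0: "0 \<le> ?g t" if "0 \<le> t" "t \<le> 0" for t
      proof -
        have "t = 0" using that by simp
        then show ?thesis using x0 by simp
      qed
      note wp = walk_passage[OF gg(1) order_refl order_refl tendsto_const reciprocal_Suc_seq x0 order_refl True le0]
      have ev: "eventually (\<lambda>n. walk_neg (1 - c) (?D n \<omega>)) sequentially"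
        using wp(1) unfolding steps_path g0 .
      have "a \<longlonglongrightarrow> \<tau>" using wp(2) unfolding steps_path g0 a_def \<tau>_def by simp
      then have a'_lim: "a' \<longlonglongrightarrow> \<tau>"
        by (rule Lim_transform_eventually) (use ev in eventually_elim, simp add: a'_def)
      have f\<tau>: "?f \<tau> = c" using \<tau>(2) by simp
      have "(\<lambda>n. walk_fun (?f \<tau>) (?h n) H (steps (a' n) (?h n) ?f)) \<longlonglongrightarrow> path_fun \<tau> H ?f"
        using \<tau> a'_neg a'_lim c f\<tau> before
        by (intro walk_fun_tendsto[OF gf(1) _ _ _ reciprocal_Suc_seq _ _ _ H(1)]) auto
      then have "(\<lambda>n. walk_fun c (?h n) H (steps (a' n) (?h n) ?f)) \<longlonglongrightarrow> path_fun \<tau> H ?f"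
        unfolding f\<tau> .
      then have "(\<lambda>n. walk_fun c (?h n) H (\<lambda>i. ?D n \<omega> (walk_time (1 - c) (?D n \<omega>) + i)))
          \<longlonglongrightarrow> path_fun \<tau> H ?f"
      proof (rule Lim_transform_eventually)
        show "\<forall>\<^sub>F n in sequentially. walk_fun c (?h n) H (steps (a' n) (?h n) ?f) =
            walk_fun c (?h n) H (\<lambda>i. ?D n \<omega> (walk_time (1 - c) (?D n \<omega>) + i))"
          using ev
        proof eventually_elim
          case (elim n)
          \<comment> \<open>\<open>a n\<close> is itself a grid time, so sampling from there only
            shifts the index of the steps.\<close>
          have "steps (a' n) (?h n) ?f = (\<lambda>i. ?D n \<omega> (walk_time (1 - c) (?D n \<omega>) + i))"
            using elim by (simp add: fun_eq_iff steps_def a'_def a_def add_divide_distrib add_ac)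
          then show ?case by simp
        qed
      qed
      from tendsto_mult[OF limG this] show ?thesis unfolding F_def \<tau>_def .
    qed
  qed
  show P_meas: "?P \<in> borel_measurable M"
    by (rule borel_measurable_LIMSEQ_metric[OF F_path_meas lim])
  have 1: "(\<lambda>n. \<integral>\<omega>. F n (?D n \<omega>) \<partial>M) \<longlonglongrightarrow> (\<integral>\<omega>. ?P \<omega> \<partial>M)"
    by (rule integral_dominated_convergence[where w="\<lambda>_. 1", OF P_meas F_path_meas])
       (use F_le lim in auto)
  have "(\<lambda>n. (\<integral>\<omega>. walk_fun (1 - c) (?h n) G (?D n \<omega>) \<partial>M) * (\<integral>\<omega>. walk_fun c (?h n) H (?D n \<omega>) \<partial>M))
    \<longlonglongrightarrow> (\<integral>\<omega>. path_fun 0 G (path_from (1 - c) \<omega>) \<partial>M) * (\<integral>\<omega>. path_fun 0 H (path_from c \<omega>) \<partial>M)"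
    using y c(1) G H by (intro tendsto_mult expectation_walk_fun_tendsto reciprocal_Suc_seq) auto
  moreover have "(\<integral>\<omega>. walk_fun (1 - c) (?h n) G (?D n \<omega>) \<partial>M) * (\<integral>\<omega>. walk_fun c (?h n) H (?D n \<omega>) \<partial>M)
      = (\<integral>\<omega>. F n (?D n \<omega>) \<partial>M)" for n
  proof -
    let ?\<nu> = "distr M borel (\<lambda>\<omega>. L (?h n) \<omega> - 1)"
    have "(\<lambda>\<omega>. L (?h n) \<omega> - 1) \<in> borel_measurable M"
      by (intro borel_measurable_diff meas borel_measurable_const) simp
    then have \<nu>: "prob_space ?\<nu>"
      by (rule prob_space_distr)
    have \<nu>s: "sets ?\<nu> = sets borel"
      by (rule sets_distr)
    have tr: "(\<integral>\<omega>. U (?D n \<omega>) \<partial>M) = (\<integral>D. U D \<partial>Pi\<^sub>M UNIV (\<lambda>_. ?\<nu>))"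
      if "U \<in> borel_measurable seq_borel" for U :: "(nat \<Rightarrow> real) \<Rightarrow> complex"
      unfolding law[OF reciprocal_Suc_seq(1), symmetric] by (rule integral_distr[OF mD that, symmetric])
    show ?thesis
      unfolding tr[OF mG] tr[OF mH] tr[OF F_meas] unfolding F_def
      by (rule walk_strong_markov[OF \<nu> \<nu>s G mH norm_walk_fun_le[OF H(2)], symmetric])
  qed
  ultimately show "(\<integral>\<omega>. ?P \<omega> \<partial>M)
    = (\<integral>\<omega>. path_fun 0 G (path_from (1 - c) \<omega>) \<partial>M) * (\<integral>\<omega>. path_fun 0 H (path_from c \<omega>) \<partial>M)"
    using LIMSEQ_unique[OF 1] by simp
qed

end

subsection \<open>The area until the first passage\<close>

text \<open>Preimages under the two functions differ inside a null set. This is how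
  \<open>area_until_zero\<close>, known only almost everywhere, becomes a random variable.\<close>

lemma borel_measurable_completion_AE_cong:
  assumes g: "g \<in> borel_measurable (completion M)" and ae: "AE x in completion M. f x = g x"
  shows "f \<in> borel_measurable (completion M)"
proof (rule measurableI)
  fix A :: "'b set" assume "A \<in> sets borel"
  then have A: "g -` A \<inter> space (completion M) \<in> sets (completion M)" by (rule measurable_sets[OF g])
  have "AE x in completion M. x \<in> g -` A \<inter> space (completion M) \<longleftrightarrow> x \<in> f -` A \<inter> space (completion M)"
    using ae by eventually_elim auto
  from completion.in_sets_AE[OF this A]
  show "f -` A \<inter> space (completion M) \<in> sets (completion M)" by simp
qed simp

lemma area_to_neg_nonneg: "0 \<le> area_to_neg 0 f"
  unfolding area_to_neg_def set_lebesgue_integral_def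
proof (rule Bochner_Integration.integral_nonneg)
  fix t
  show "0 \<le> indicat_real {0<..<first_neg f} t *\<^sub>R f t"
    using before_first_neg[of t f] by (cases "t \<in> {0<..<first_neg f}") auto
qed

context stable_paths
begin

text \<open>Until \<open>\<tau>\<close> the path from 1 is the copy from \<open>1 - c\<close> raised
  by \<open>c\<close>, which accounts for the rectangle \<open>c * \<tau>\<close>. The copy lies
  below the path and so passes zero no later.\<close>

lemma area_split:
  assumes \<omega>: "\<omega> \<in> space M" and c: "0 < c" "c < 1" and neg1: "goes_neg (path_from 1 \<omega>)"
  defines "\<tau> \<equiv> first_neg (path_from (1 - c) \<omega>)"
  shows "goes_neg (path_from (1 - c) \<omega>)" (is ?thesis1)
    and "area_to_neg 0 (path_from 1 \<omega>)
      = area_to_neg 0 (path_from (1 - c) \<omega>) + c * \<tau> + area_to_neg \<tau> (path_from 1 \<omega>)" (is ?thesis2)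
proof -
  let ?f = "path_from 1 \<omega>" and ?g = "path_from (1 - c) \<omega>"
  let ?T = "first_neg ?f"
  show neg2: ?thesis1 using neg1 c by (force simp: goes_neg_def)
  have \<tau>0: "0 \<le> \<tau>" unfolding \<tau>_def by (rule first_neg_nonneg[OF neg2])
  have \<tau>T: "\<tau> \<le> ?T"
    unfolding \<tau>_def using c by (intro first_neg_ge[OF neg1] first_neg_le) auto
  have int: "set_integrable lborel {0<..<first_neg (path_from x \<omega>)} (path_from x \<omega>)"
    if "goes_neg (path_from x \<omega>)" "0 < x" for x
  proof -
    note P = path_good[OF \<omega>, of x]
    have x: "0 < path_from x \<omega> 0" using P(3) that(2) by simp
    have "0 \<le> path_from x \<omega> t" if "0 \<le> t" "t \<le> 0" for t
    proof -
      have "t = 0" using that by simp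
      then show ?thesis using x by simp
    qed
    from walk_passage(4)[OF P(1) order_refl order_refl tendsto_const reciprocal_Suc_seq x order_refl that(1) this]
    show ?thesis .
  qed
  have Ioo: "(LBINT t=ereal a..ereal b. u t) = (LINT t:{a<..<b}|lborel. u t)" if "a \<le> b" for a b u
    using that interval_integral_Ioo[of "ereal a" "ereal b" u] by simp
  \<comment> \<open>Interval integrals join the two open intervals across the single point
    \<open>\<tau>\<close>.\<close>
  have "(LBINT t=ereal 0..ereal \<tau>. ?f t) + (LBINT t=ereal \<tau>..ereal ?T. ?f t) = (LBINT t=ereal 0..ereal ?T. ?f t)"
    using \<tau>0 \<tau>T int[OF neg1]
    by (intro interval_integral_sum)
       (simp add: interval_lebesgue_integrable_def einterval_eq min_def max_def)
  then have "area_to_neg 0 ?f = (LINT t:{0<..<\<tau>}|lborel. ?f t) + area_to_neg \<tau> ?f"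
    using \<tau>0 \<tau>T by (simp add: Ioo area_to_neg_def)
  also have "(LINT t:{0<..<\<tau>}|lborel. ?f t) = (LINT t:{0<..<\<tau>}|lborel. ?g t + c)"
    by simp
  also have "\<dots> = (LINT t:{0<..<\<tau>}|lborel. ?g t) + (LINT t:{0<..<\<tau>}|lborel. c)"
  proof (rule set_integral_add)
    show "set_integrable lborel {0<..<\<tau>} ?g"
      unfolding \<tau>_def using c by (intro int neg2) simp
    show "set_integrable lborel {0<..<\<tau>} (\<lambda>_. c)"
      unfolding set_integrable_def using \<tau>0
      by (intro integrable_scaleR_left integrable_real_indicator) auto
  qed
  also have "(LINT t:{0<..<\<tau>}|lborel. c) = c * \<tau>"
    using \<tau>0 by (simp add: set_lebesgue_integral_def)
  also have "(LINT t:{0<..<\<tau>}|lborel. ?g t) = area_to_neg 0 ?g"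
    by (simp add: area_to_neg_def \<tau>_def)
  finally show ?thesis2 .
qed

section \<open>Almost sure passage and the hitting time of zero\<close>

lemma measurable_goes_neg[measurable]:
  assumes "0 < x"
  shows "Measurable.pred M (\<lambda>\<omega>. goes_neg (path_from x \<omega>))"
proof -
  have "(\<lambda>\<omega>. path_fun 0 (\<lambda>_. 1) (path_from x \<omega>)) \<in> borel_measurable M"
    by (rule borel_measurable_path_fun[OF assms]) simp
  then have "Measurable.pred M (\<lambda>\<omega>. path_fun 0 (\<lambda>_. 1) (path_from x \<omega>) = 1)" by measurable
  moreover have "path_fun 0 (\<lambda>_. 1) (path_from x \<omega>) = 1 \<longleftrightarrow> goes_neg (path_from x \<omega>)" for \<omega>
    by (simp add: path_fun_def)
  ultimately show ?thesis by simp
qed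

text \<open>By scaling, the probability \<open>q\<close> of going negative does not depend on the starting level;
  by the Markov property \<open>q = q * q\<close>; and \<open>q = 0\<close> is impossible since \<open>L 1 < L 0\<close> with
  positive probability.\<close>

lemma AE_goes_neg:
  assumes "0 < x"
  shows "AE \<omega> in M. goes_neg (path_from x \<omega>)"
proof -
  define q where "q y = prob {\<omega> \<in> space M. goes_neg (path_from y \<omega>)}" for y
  have int_q: "(\<integral>\<omega>. path_fun 0 (\<lambda>_. 1) (path_from y \<omega>) \<partial>M) = complex_of_real (q y)" if "0 < y" for y
  proof -
    have m: "{\<omega> \<in> space M. goes_neg (path_from y \<omega>)} \<in> sets M"
      using measurable_goes_neg[OF that] by measurable
    have "(\<integral>\<omega>. path_fun 0 (\<lambda>_. 1) (path_from y \<omega>) \<partial>M)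
        = (\<integral>\<omega>. complex_of_real (indicator {\<omega> \<in> space M. goes_neg (path_from y \<omega>)} \<omega>) \<partial>M)"
      by (intro Bochner_Integration.integral_cong) (auto simp: path_fun_def indicator_def)
    also have "\<dots> = complex_of_real (\<integral>\<omega>. indicator {\<omega> \<in> space M. goes_neg (path_from y \<omega>)} \<omega> \<partial>M)"
      by (rule integral_complex_of_real)
    also have "(\<integral>\<omega>. indicator {\<omega> \<in> space M. goes_neg (path_from y \<omega>)} \<omega> \<partial>M) = q y"
      unfolding q_def using m by simp
    finally show ?thesis .
  qed
  have q_eq: "q y = q 1" if "0 < y" for y
  proof -
    have "(\<integral>\<omega>. path_fun 0 (\<lambda>_. 1) (path_from y \<omega>) \<partial>M) = (\<integral>\<omega>. path_fun 0 (\<lambda>(s, a). 1) (path_from 1 \<omega>) \<partial>M)"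
      by (rule path_fun_scale[OF that]) auto
    then show ?thesis using int_q[OF that] int_q[of 1] by (simp add: case_prod_beta')
  qed
  \<comment> \<open>Any level strictly between 0 and 1 would do in place of 1/2. A path that passes
    zero has passed this level before, so the product with constant functionals is again the
    indicator of passage.\<close>
  have "complex_of_real (q 1) = (\<integral>\<omega>. path_fun 0 (\<lambda>_. 1) (path_from (1 - 1/2) \<omega>) *
      path_fun (first_neg (path_from (1 - 1/2) \<omega>)) (\<lambda>_. 1) (path_from 1 \<omega>) \<partial>M)"
    unfolding int_q[OF zero_less_one, symmetric]
  proof (intro Bochner_Integration.integral_cong refl)
    fix \<omega> assume "\<omega> \<in> space M"
    from area_split(1)[OF this, of "1/2"]
    show "path_fun 0 (\<lambda>_. 1) (path_from 1 \<omega>) = path_fun 0 (\<lambda>_. 1) (path_from (1 - 1/2) \<omega>) *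
      path_fun (first_neg (path_from (1 - 1/2) \<omega>)) (\<lambda>_. 1) (path_from 1 \<omega>)"
      by (simp add: path_fun_def)
  qed
  also have "\<dots> = (\<integral>\<omega>. path_fun 0 (\<lambda>_. 1) (path_from (1 - 1/2) \<omega>) \<partial>M) * (\<integral>\<omega>. path_fun 0 (\<lambda>_. 1) (path_from (1/2) \<omega>) \<partial>M)"
    by (rule strong_markov(2)) auto
  also have "\<dots> = complex_of_real (q 1 * q 1)"
    using int_q[of "1/2"] q_eq[of "1/2"] by simp
  finally have qq: "q 1 = q 1 * q 1" by (simp only: of_real_eq_iff)
  have "q 1 \<noteq> 0"
  proof
    assume "q 1 = 0"
    \<comment> \<open>Starting levels tending to 0 are used: no passage from any of them forces
      \<open>L 1\<close> to be at least 1, against \<open>neg\<close>.\<close>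
    have "AE \<omega> in M. \<not> goes_neg (path_from (1 / real (Suc n)) \<omega>)" for n
    proof -
      have n: "0 < 1 / real (Suc n)" by (rule reciprocal_Suc_seq)
      have "q (1 / real (Suc n)) = 0" using q_eq[OF n] \<open>q 1 = 0\<close> by simp
      moreover have "{\<omega> \<in> space M. goes_neg (path_from (1 / real (Suc n)) \<omega>)} \<in> sets M"
        using measurable_goes_neg[OF n] by measurable
      ultimately have "{\<omega> \<in> space M. goes_neg (path_from (1 / real (Suc n)) \<omega>)} \<in> null_sets M"
        unfolding q_def by (simp add: null_sets_def emeasure_eq_measure)
      then show ?thesis by (rule AE_I') auto
    qed
    then have "AE \<omega> in M. \<forall>n. \<not> goes_neg (path_from (1 / real (Suc n)) \<omega>)"
      by (simp add: AE_all_countable)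
    then have "AE \<omega> in M. 1 \<le> L 1 \<omega>"
    proof eventually_elim
      case (elim \<omega>)
      have le: "1 - 1 / real (Suc n) \<le> L 1 \<omega>" for n
        using elim[rule_format, of n] unfolding goes_neg_def by (auto dest!: spec[of _ 1])
      have "(\<lambda>n. 1 - 1 / real (Suc n)) \<longlonglongrightarrow> 1 - 0"
        by (intro tendsto_diff tendsto_const reciprocal_Suc_seq)
      from LIMSEQ_le_const2[OF this] le show ?case by auto
    qed
    with neg show False by simp
  qed
  with qq have "q x = 1" using q_eq[OF assms] by simp
  moreover have "{\<omega> \<in> space M. goes_neg (path_from x \<omega>)} \<in> sets M"
    using measurable_goes_neg[OF assms] by measurable
  ultimately have "AE \<omega> in M. \<omega> \<in> {\<omega> \<in> space M. goes_neg (path_from x \<omega>)}"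
    unfolding q_def by (simp add: prob_eq_1)
  then show ?thesis by simp
qed

text \<open>The paths could a priori approach zero and jump away from it at the limit time. The passage
  times below the levels \<open>1/n\<close> increase to a limit no larger than the passage time below zero,
  and by scaling the Laplace transforms converge to that of the passage time below zero, so the
  two times agree.\<close>

lemma AE_hitting_time:
  "AE \<omega> in M. hitting_time_zero (\<lambda>t. L t \<omega>) = ereal (first_neg (path_from 1 \<omega>))"
proof -
  \<comment> \<open>The double successor keeps the starting level positive at
    \<open>n = 0\<close>.\<close>
  let ?x = "\<lambda>n. 1 - 1 / real (Suc (Suc n))"
  have x: "0 < ?x n" "?x n < 1" for n by (simp_all add: field_simps)
  have x_lim: "?x \<longlonglongrightarrow> 1"
    using tendsto_diff[OF tendsto_const LIMSEQ_Suc[OF reciprocal_Suc_seq(2)], of 1] by simp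
  define G :: "real \<times> real \<Rightarrow> complex" where "G = (\<lambda>z. of_real (exp (- \<bar>fst z\<bar>)))"
  have G: "continuous_on UNIV G" "norm (G z) \<le> 1" for z
    unfolding G_def by (auto intro!: continuous_intros)
  define E where "E y \<omega> = path_fun 0 G (path_from y \<omega>)" for y \<omega>
  have E1: "norm (E y \<omega>) \<le> 1" for y \<omega> using G(2) by (simp add: E_def path_fun_def)
  have intE: "integrable M (E y)" if "0 < y" for y
  proof (rule integrable_const_bound[where B=1])
    show "E y \<in> borel_measurable M" unfolding E_def by (rule borel_measurable_path_fun[OF that G(1)])
  qed (simp add: E1)
  \<comment> \<open>Scaling moves the varying starting level from the path into the functional,
    where continuity handles its limit 1.\<close>
  define G' where "G' n = (\<lambda>(s, a). G (?x n powr \<alpha> * s, ?x n powr (\<alpha> + 1) * a))" for n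
  have G': "continuous_on UNIV (G' n)" for n
    unfolding G'_def split_beta' by (rule continuous_on_compose2[OF G(1)]) (intro continuous_intros, simp)
  have "(\<lambda>n. \<integral>\<omega>. path_fun 0 (G' n) (path_from 1 \<omega>) \<partial>M) \<longlonglongrightarrow> (\<integral>\<omega>. E 1 \<omega> \<partial>M)"
  proof (rule integral_dominated_convergence[where w="\<lambda>_. 1"])
    show "E 1 \<in> borel_measurable M" using intE[of 1] by simp
    show "AE \<omega> in M. (\<lambda>n. path_fun 0 (G' n) (path_from 1 \<omega>)) \<longlonglongrightarrow> E 1 \<omega>"
    proof (intro AE_I2)
      fix \<omega>
      have "(\<lambda>n. G' n z) \<longlonglongrightarrow> G (1 powr \<alpha> * fst z, 1 powr (\<alpha> + 1) * snd z)" for z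
        unfolding G'_def split_beta using x_lim
        by (intro continuous_on_tendsto_compose[OF G(1)] tendsto_intros) auto
      then show "(\<lambda>n. path_fun 0 (G' n) (path_from 1 \<omega>)) \<longlonglongrightarrow> E 1 \<omega>"
        unfolding E_def path_fun_def by (cases "goes_neg (path_from 1 \<omega>)") auto
    qed
    show "(\<lambda>\<omega>. path_fun 0 (G' n) (path_from 1 \<omega>)) \<in> borel_measurable M" for n
      by (rule borel_measurable_path_fun[OF zero_less_one G'])
    show "AE \<omega> in M. norm (path_fun 0 (G' n) (path_from 1 \<omega>)) \<le> 1" for n
      using G(2) by (auto simp: path_fun_def G'_def split_beta)
  qed auto
  then have "(\<lambda>n. \<integral>\<omega>. E (?x n) \<omega> \<partial>M) \<longlonglongrightarrow> (\<integral>\<omega>. E 1 \<omega> \<partial>M)"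
    unfolding E_def G'_def path_fun_scale[OF x(1) G] .
  then have "(\<lambda>n. Re ((\<integral>\<omega>. E (?x n) \<omega> \<partial>M) - (\<integral>\<omega>. E 1 \<omega> \<partial>M))) \<longlonglongrightarrow> Re 0"
    by (intro tendsto_Re) (rule LIM_zero)
  \<comment> \<open>The lower start passes zero earlier, so the difference is real and nonnegative
    pointwise. Convergence of expectations is therefore convergence in L1, which yields an almost
    everywhere convergent subsequence.\<close>
  moreover have "Re ((\<integral>\<omega>. E (?x n) \<omega> \<partial>M) - (\<integral>\<omega>. E 1 \<omega> \<partial>M)) = (\<integral>\<omega>. norm (E (?x n) \<omega> - E 1 \<omega>) \<partial>M)" for n
  proof -
    have "Re ((\<integral>\<omega>. E (?x n) \<omega> \<partial>M) - (\<integral>\<omega>. E 1 \<omega> \<partial>M)) = (\<integral>\<omega>. Re (E (?x n) \<omega> - E 1 \<omega>) \<partial>M)"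
      using intE[OF x(1)] intE[OF zero_less_one] by (simp del: of_nat_Suc)
    also have "\<dots> = (\<integral>\<omega>. norm (E (?x n) \<omega> - E 1 \<omega>) \<partial>M)"
    proof (intro Bochner_Integration.integral_cong refl)
      fix \<omega> assume "\<omega> \<in> space M"
      have sub: "goes_neg (path_from (?x n) \<omega>)" "first_neg (path_from (?x n) \<omega>) \<le> first_neg (path_from 1 \<omega>)"
        if n1: "goes_neg (path_from 1 \<omega>)"
      proof -
        have lt: "path_from (?x n) \<omega> t < 0" if "path_from 1 \<omega> t < 0" for t
          using x(2)[of n] that by linarith
        then show "goes_neg (path_from (?x n) \<omega>)" using n1 unfolding goes_neg_def by blast
        show "first_neg (path_from (?x n) \<omega>) \<le> first_neg (path_from 1 \<omega>)"
          using lt by (intro first_neg_ge[OF n1] first_neg_le)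
      qed
      define r where "r y = (if goes_neg (path_from y \<omega>) then exp (- first_neg (path_from y \<omega>)) else 0)" for y
      have "E y \<omega> = complex_of_real (r y)" for y
        using first_neg_nonneg[of "path_from y \<omega>"] by (simp add: E_def r_def path_fun_def G_def)
      moreover have "r 1 \<le> r (?x n)" using sub by (simp add: r_def)
      ultimately show "Re (E (?x n) \<omega> - E 1 \<omega>) = norm (E (?x n) \<omega> - E 1 \<omega>)"
        by (simp flip: of_real_diff del: of_nat_Suc)
    qed
    finally show ?thesis .
  qed
  ultimately have "(\<lambda>n. \<integral>\<omega>. norm (E (?x n) \<omega> - E 1 \<omega>) \<partial>M) \<longlonglongrightarrow> 0" by simp
  from tendsto_L1_AE_subseq[OF Bochner_Integration.integrable_diff[OF intE[OF x(1)] intE[OF zero_less_one]] this]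
  obtain r :: "nat \<Rightarrow> nat" where r: "AE \<omega> in M. (\<lambda>n. E (?x (r n)) \<omega> - E 1 \<omega>) \<longlonglongrightarrow> 0" by blast
  have "AE \<omega> in M. \<forall>n. goes_neg (path_from (?x n) \<omega>)"
    unfolding AE_all_countable using x by (intro allI AE_goes_neg)
  with r AE_goes_neg[OF zero_less_one] AE_space show ?thesis
  proof eventually_elim
    case (elim \<omega>)
    define \<tau> where "\<tau> = first_neg (path_from 1 \<omega>)"
    define \<tau>' where "\<tau>' n = first_neg (path_from (?x (r n)) \<omega>)" for n
    have nn: "0 \<le> \<tau>" "0 \<le> \<tau>' n" for n
      unfolding \<tau>_def \<tau>'_def using elim by (auto intro: first_neg_nonneg)
    have EE: "E 1 \<omega> = of_real (exp (- \<tau>))" "E (?x (r n)) \<omega> = of_real (exp (- \<tau>' n))" for n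
      unfolding E_def path_fun_def G_def using elim nn nn(2)[of n] by (simp_all add: \<tau>_def \<tau>'_def)
    have "(\<lambda>n. complex_of_real (exp (- \<tau>' n))) \<longlonglongrightarrow> complex_of_real (exp (- \<tau>))"
      using elim(1) unfolding EE by (rule LIM_zero_cancel)
    then have "(\<lambda>n. exp (- \<tau>' n)) \<longlonglongrightarrow> exp (- \<tau>)" by (simp only: tendsto_of_real_iff)
    then have "(\<lambda>n. ln (exp (- \<tau>' n))) \<longlonglongrightarrow> ln (exp (- \<tau>))" by (rule tendsto_ln) simp
    then have \<tau>_lim: "\<tau>' \<longlonglongrightarrow> \<tau>" using tendsto_minus_cancel[of \<tau>'] by simp
    note P = path_good[OF elim(3), of 1]
    have "0 < \<tau>" "path_from 1 \<omega> \<tau> = 0"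
      unfolding \<tau>_def using first_neg_eq_0[OF P(1,2) elim(2)] P(3) by simp_all
    then have mem: "\<tau> \<in> {t. 0 < t \<and> L t \<omega> = 0}" by simp
    have "\<tau> \<le> t" if t: "0 < t" "L t \<omega> = 0" for t
    proof -
      \<comment> \<open>At a zero of \<open>L\<close> the copy started below 1 is already
        negative.\<close>
      have "\<tau>' n \<le> t" for n
        unfolding \<tau>'_def using t x(2)[of "r n"] by (intro first_neg_le) auto
      then show ?thesis using LIMSEQ_le_const2[OF \<tau>_lim] by blast
    qed
    with mem have "Inf (ereal ` {t. 0 < t \<and> L t \<omega> = 0}) = ereal \<tau>"
      by (intro antisym Inf_lower INF_greatest imageI) auto
    then show ?case unfolding hitting_time_zero_def \<tau>_def .
  qed
qed

section \<open>The area as a random variable and its decomposition\<close>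

definition area :: "'w \<Rightarrow> real" where
  "area \<omega> = Re (path_fun 0 (\<lambda>z. of_real (snd z)) (path_from 1 \<omega>))"

text \<open>The area under the path from 1 until it passes below \<open>c\<close>, rectangle
  included. Both areas are written through \<open>path_fun\<close>, which supplies
  measurability.\<close>

definition area_above :: "real \<Rightarrow> 'w \<Rightarrow> real" where
  "area_above c \<omega> = Re (path_fun 0 (\<lambda>z. of_real (snd z + c * fst z)) (path_from (1 - c) \<omega>))"

lemma measurable_area[measurable]: "area \<in> borel_measurable M"
proof -
  have [measurable]: "(\<lambda>\<omega>. path_fun 0 (\<lambda>z. of_real (snd z)) (path_from 1 \<omega>)) \<in> borel_measurable M"
    by (rule borel_measurable_path_fun[OF zero_less_one]) (intro continuous_intros)
  show ?thesis unfolding area_def by measurable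
qed

lemma measurable_area_above:
  assumes "c < 1"
  shows "area_above c \<in> borel_measurable M"
proof -
  have "0 < 1 - c" using assms by simp
  then have [measurable]: "(\<lambda>\<omega>. path_fun 0 (\<lambda>z. of_real (snd z + c * fst z)) (path_from (1 - c) \<omega>)) \<in> borel_measurable M"
    by (rule borel_measurable_path_fun) (intro continuous_intros)
  show ?thesis unfolding area_above_def by measurable
qed

lemma area_eq: "goes_neg (path_from 1 \<omega>) \<Longrightarrow> area \<omega> = area_to_neg 0 (path_from 1 \<omega>)"
  by (simp add: area_def path_fun_def)

lemma area_nonneg: "0 \<le> area \<omega>"
  using area_to_neg_nonneg[of "path_from 1 \<omega>"] by (simp add: area_def path_fun_def)

lemma AE_area_until_zero: "AE \<omega> in M. area_until_zero L \<omega> = area \<omega>"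
  using AE_hitting_time AE_goes_neg[OF zero_less_one]
proof eventually_elim
  case (elim \<omega>)
  have "area_until_zero L \<omega> = (LBINT s=ereal 0..ereal (first_neg (path_from 1 \<omega>)). path_from 1 \<omega> s)"
    unfolding area_until_zero_def elim(1) by (simp add: zero_ereal_def)
  also have "\<dots> = area_to_neg 0 (path_from 1 \<omega>)"
    using first_neg_nonneg[OF elim(2)] interval_integral_Ioo[of "ereal 0" "ereal (first_neg (path_from 1 \<omega>))" "path_from 1 \<omega>"]
    by (simp add: area_to_neg_def)
  finally show ?case using area_eq[OF elim(2)] by simp
qed

text \<open>The exponential turns the sum in \<open>area_split\<close> into a product that
  \<open>strong_markov\<close> separates; \<open>path_fun_scale\<close> then brings the part after
  the passage back to the starting level 1.\<close>

lemma char_area_factor: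
  assumes c: "0 < c" "c < 1"
  shows "(\<integral>\<omega>. iexp (t * area \<omega>) \<partial>M)
    = (\<integral>\<omega>. iexp (t * area_above c \<omega>) \<partial>M) * (\<integral>\<omega>. iexp (t * (c powr (\<alpha> + 1) * area \<omega>)) \<partial>M)"
proof -
  define G :: "real \<times> real \<Rightarrow> complex" where "G = (\<lambda>z. iexp (t * (snd z + c * fst z)))"
  define H :: "real \<times> real \<Rightarrow> complex" where "H = (\<lambda>z. iexp (t * snd z))"
  have G: "continuous_on UNIV G" "norm (G z) \<le> 1" for z
    unfolding G_def by (auto intro!: continuous_intros)
  have H: "continuous_on UNIV H" "norm (H z) \<le> 1" for z
    unfolding H_def by (auto intro!: continuous_intros)
  note [measurable] = measurable_area_above[OF c(2)] strong_markov(1)[OF c G H]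
  have [measurable]: "(\<lambda>\<omega>. path_fun 0 G (path_from (1 - c) \<omega>)) \<in> borel_measurable M"
    using c G by (intro borel_measurable_path_fun) auto
  have H': "continuous_on UNIV (\<lambda>(s, a). H (c powr \<alpha> * s, c powr (\<alpha> + 1) * a))"
    unfolding split_beta' by (rule continuous_on_compose2[OF H(1)]) (intro continuous_intros, simp)
  have [measurable]: "(\<lambda>\<omega>. path_fun 0 (\<lambda>(s, a). H (c powr \<alpha> * s, c powr (\<alpha> + 1) * a)) (path_from 1 \<omega>)) \<in> borel_measurable M"
    by (rule borel_measurable_path_fun[OF zero_less_one H'])
  have y: "0 < 1 - c" using c by simp
  have "(\<integral>\<omega>. iexp (t * area \<omega>) \<partial>M) = (\<integral>\<omega>. path_fun 0 G (path_from (1 - c) \<omega>) *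
      path_fun (first_neg (path_from (1 - c) \<omega>)) H (path_from 1 \<omega>) \<partial>M)"
  proof (rule integral_cong_AE)
    show "AE \<omega> in M. iexp (t * area \<omega>) = path_fun 0 G (path_from (1 - c) \<omega>) *
      path_fun (first_neg (path_from (1 - c) \<omega>)) H (path_from 1 \<omega>)"
      using AE_goes_neg[OF zero_less_one] AE_space
    proof eventually_elim
      case (elim \<omega>)
      note S = area_split[OF elim(2) c elim(1)]
      show ?case
        using S(1) elim(1) unfolding area_eq[OF elim(1)] S(2)
        by (simp add: path_fun_def G_def H_def distrib_left exp_add)
    qed
  qed measurable
  also have "\<dots> = (\<integral>\<omega>. path_fun 0 G (path_from (1 - c) \<omega>) \<partial>M) * (\<integral>\<omega>. path_fun 0 H (path_from c \<omega>) \<partial>M)"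
    by (rule strong_markov(2)[OF c G H])
  also have "(\<integral>\<omega>. path_fun 0 G (path_from (1 - c) \<omega>) \<partial>M) = (\<integral>\<omega>. iexp (t * area_above c \<omega>) \<partial>M)"
  proof (rule integral_cong_AE)
    show "AE \<omega> in M. path_fun 0 G (path_from (1 - c) \<omega>) = iexp (t * area_above c \<omega>)"
      using AE_goes_neg[OF y] by eventually_elim (simp add: path_fun_def area_above_def G_def)
  qed measurable
  also have "(\<integral>\<omega>. path_fun 0 H (path_from c \<omega>) \<partial>M)
      = (\<integral>\<omega>. path_fun 0 (\<lambda>(s, a). H (c powr \<alpha> * s, c powr (\<alpha> + 1) * a)) (path_from 1 \<omega>) \<partial>M)"
    by (rule path_fun_scale[OF c(1) H])
  also have "\<dots> = (\<integral>\<omega>. iexp (t * (c powr (\<alpha> + 1) * area \<omega>)) \<partial>M)"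
  proof (rule integral_cong_AE)
    show "AE \<omega> in M. path_fun 0 (\<lambda>(s, a). H (c powr \<alpha> * s, c powr (\<alpha> + 1) * a)) (path_from 1 \<omega>)
        = iexp (t * (c powr (\<alpha> + 1) * area \<omega>))"
      using AE_goes_neg[OF zero_less_one]
      by eventually_elim (simp add: path_fun_def area_def H_def)
  qed measurable
  finally show ?thesis .
qed

text \<open>On the product of the laws of \<open>area\<close> and \<open>area_above c\<close> the
  coordinates are independent by construction. Only the law of the sum remains to be identified, and
  there Levy's uniqueness theorem applies.\<close>

lemma area_decomposition:
  assumes k: "0 < k" "k < 1"
  shows "\<exists>(N :: (real \<times> real) measure) Y Z. prob_space N \<and> prob_space.indep_var N borel Y borel Z \<and>
    distr N borel Y = distr M borel area \<and> distr M borel area = distr N borel (\<lambda>\<omega>. k * Y \<omega> + Z \<omega>)"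
proof -
  \<comment> \<open>The level for which the area after the passage scales by exactly
    \<open>k\<close>.\<close>
  define c where "c = k powr (1 / (\<alpha> + 1))"
  have c: "0 < c" "c < 1" "c powr (\<alpha> + 1) = k"
    using k \<alpha> powr_less_mono2[of "1 / (\<alpha> + 1)" k 1] by (auto simp: c_def powr_powr)
  note [measurable] = measurable_area_above[OF c(2)]
  interpret A: real_distribution "distr M borel area" by (rule real_distribution_distr) measurable
  interpret B: real_distribution "distr M borel (area_above c)" by (rule real_distribution_distr) measurable
  interpret N: pair_prob_space "distr M borel area" "distr M borel (area_above c)" ..
  let ?N = "distr M borel area \<Otimes>\<^sub>M distr M borel (area_above c)"
  have N: "distr ?N borel fst = distr M borel area" "distr ?N borel snd = distr M borel (area_above c)"
  proof -
    have "distr ?N borel fst = distr ?N (distr M borel area) fst" by (rule distr_cong) auto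
    then show "distr ?N borel fst = distr M borel area" using B.distr_pair_fst by simp
    show "distr ?N borel snd = distr M borel (area_above c)"
    proof (rule measure_eqI)
      fix X assume "X \<in> sets (distr ?N borel snd)"
      then have X: "X \<in> sets (distr M borel (area_above c))" by simp
      then have "emeasure (distr ?N borel snd) X = emeasure ?N (UNIV \<times> X)"
        by (subst emeasure_distr) (auto intro!: arg_cong2[where f=emeasure] simp: space_pair_measure)
      also have "\<dots> = emeasure (distr M borel area) UNIV * emeasure (distr M borel (area_above c)) X"
        using X by (intro B.emeasure_pair_measure_Times) auto
      finally show "emeasure (distr ?N borel snd) X = emeasure (distr M borel (area_above c)) X"
        using A.emeasure_space_1 by simp
    qed simp
  qed
  have indep: "N.indep_var borel fst borel snd"
    unfolding N.indep_var_distribution_eq N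
  proof (intro conjI)
    have "distr ?N (borel \<Otimes>\<^sub>M borel) (\<lambda>x. (fst x, snd x)) = distr ?N ?N (\<lambda>x. x)"
      by (rule distr_cong) (auto intro!: sets_pair_measure_cong)
    then show "?N = distr ?N (borel \<Otimes>\<^sub>M borel) (\<lambda>x. (fst x, snd x))" by simp
  qed measurable
  have indep': "N.indep_var borel (\<lambda>z. k * fst z) borel snd"
  proof -
    have "N.indep_var borel ((\<lambda>x. k * x) \<circ> fst) borel ((\<lambda>x. x) \<circ> snd)"
      by (rule N.indep_var_compose[OF indep]) measurable
    then show ?thesis unfolding comp_def .
  qed
  have "distr M borel area = distr ?N borel (\<lambda>z. k * fst z + snd z)"
  proof (rule Levy_uniqueness)
    show "real_distribution (distr ?N borel (\<lambda>z. k * fst z + snd z))"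
      by (rule N.real_distribution_distr) measurable
    show "char (distr M borel area) = char (distr ?N borel (\<lambda>z. k * fst z + snd z))"
    proof
      fix t
      have "distr ?N borel (\<lambda>z. k * fst z) = distr (distr ?N borel fst) borel (\<lambda>x. k * x)"
        by (subst distr_distr) (simp_all only: comp_def, measurable)
      also have "\<dots> = distr M borel (\<lambda>\<omega>. k * area \<omega>)"
        unfolding N by (subst distr_distr) (simp_all only: comp_def, measurable)
      finally have Y: "distr ?N borel (\<lambda>z. k * fst z) = distr M borel (\<lambda>\<omega>. k * area \<omega>)" .
      have "char (distr ?N borel (\<lambda>z. k * fst z + snd z)) t
          = char (distr M borel (\<lambda>\<omega>. k * area \<omega>)) t * char (distr M borel (area_above c)) t"
        unfolding N.char_distr_add[OF indep'] Y N ..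
      also have "\<dots> = char (distr M borel area) t"
        using char_area_factor[OF c(1,2), of t] c(3) by (simp add: char_def integral_distr)
      finally show "char (distr M borel area) t = char (distr ?N borel (\<lambda>z. k * fst z + snd z)) t" ..
    qed
  qed (rule A.real_distribution_axioms)
  with indep N(1) N.prob_space_axioms show ?thesis by blast
qed

lemma self_decomposable_AE_area:
  assumes "AE \<omega> in M. X \<omega> = area \<omega>"
  shows "self_decomposable (completion M) X"
proof -
  have ae: "AE \<omega> in completion M. X \<omega> = area \<omega>"
    by (rule AE_completion[OF assms])
  have mA: "area \<in> borel_measurable (completion M)" by (rule measurable_completion) measurable
  have m: "X \<in> borel_measurable (completion M)"
    by (rule borel_measurable_completion_AE_cong[OF mA ae])
  have "distr (completion M) borel X = distr (completion M) borel area"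
    by (rule distr_cong_AE[OF refl refl ae m mA])
  also have "\<dots> = distr M borel area" by (rule distr_completion) measurable
  finally have d: "distr (completion M) borel X = distr M borel area" .
  have "AE \<omega> in completion M. 0 \<le> X \<omega>"
    using ae by eventually_elim (simp add: area_nonneg)
  then show ?thesis
    unfolding self_decomposable_def d using m area_decomposition prob_space_completion by auto
qed

end

subsection \<open>Regular modification and conclusion\<close>

text \<open>Independence of a sequence concerns finite subfamilies only, and each of these lies in
  an initial segment.\<close>

lemma (in prob_space) distr_iid_sequence:
  assumes X: "\<And>i. random_variable borel (X i)"
    and indep: "\<And>n. indep_vars (\<lambda>_. borel) X {..<n}"
    and id: "\<And>i. distr M borel (X i) = \<nu>"
  shows "distr M seq_borel (\<lambda>\<omega> i. X i \<omega> :: real) = Pi\<^sub>M UNIV (\<lambda>_::nat. \<nu>)"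
proof -
  have "indep_vars (\<lambda>_. borel) X UNIV"
    unfolding indep_vars_def2
  proof (intro conjI ballI X)
    show "indep_sets (\<lambda>i. {X i -` A \<inter> space M |A. A \<in> sets borel}) UNIV"
    proof (subst indep_sets_finite_index_sets, intro allI impI)
      fix J :: "nat set" assume "finite J"
      then obtain n where "J \<subseteq> {..<n}" using finite_nat_iff_bounded by blast
      with indep[of n] show "indep_sets (\<lambda>i. {X i -` A \<inter> space M |A. A \<in> sets borel}) J"
        unfolding indep_vars_def2 using indep_sets_mono_index by blast
    qed
  qed
  then have "distr M seq_borel (\<lambda>\<omega>. \<lambda>i\<in>UNIV. X i \<omega>) = Pi\<^sub>M UNIV (\<lambda>i. distr M borel (X i))"
    by (subst (asm) indep_vars_iff_distr_eq_PiM) (auto intro: X)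
  then show ?thesis by (simp add: id restrict_def)
qed

lemma cadlag_one_minus: "cadlag (\<lambda>t. 1 - t)"
proof -
  have "((\<lambda>t. 1 - t) \<longlongrightarrow> 1 - s) (at s within A)" for s :: real and A
    by (intro tendsto_intros)
  then show ?thesis unfolding cadlag_def by blast
qed

lemma no_negative_jumps_one_minus: "no_negative_jumps (\<lambda>t. 1 - t)"
  unfolding no_negative_jumps_def
proof (intro allI impI)
  fix s l :: real
  assume "((\<lambda>t. 1 - t) \<longlongrightarrow> l) (at_left s)"
  moreover have "((\<lambda>t. 1 - t) \<longlongrightarrow> 1 - s) (at_left s)" by (intro tendsto_intros)
  ultimately show "l \<le> 1 - s" using tendsto_unique[OF trivial_limit_at_left_real] by blast
qed

text \<open>The paths outside the almost sure event are replaced by the line \<open>1 - t\<close>, so that every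
  path can be treated as a regular one.\<close>

lemma stable_paths_modification:
  fixes L :: "real \<Rightarrow> 'w \<Rightarrow> real"
  assumes \<alpha>: "1 < \<alpha>" and L: "spectrally_positive_stable_from_one \<alpha> M L"
  obtains L' where "stable_paths M L' \<alpha>" "AE \<omega> in M. \<forall>t. L' t \<omega> = L t \<omega>"
proof -
  have levy: "levy_process_from 1 M L" and stable: "strictly_stable \<alpha> M L"
    and jumps: "AE \<omega> in M. no_negative_jumps (\<lambda>t. L t \<omega>)"
    and exp_L: "\<And>u. 0 \<le> u \<Longrightarrow> prob_space.expectation M (\<lambda>\<omega>. exp (- u * (L 1 \<omega> - L 0 \<omega>))) = exp (u powr \<alpha>)"
    using L by (auto simp: spectrally_positive_stable_from_one_def)
  have meas: "\<And>t. 0 \<le> t \<Longrightarrow> L t \<in> borel_measurable M" and L0: "AE \<omega> in M. L 0 \<omega> = 1"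
    and ind: "independent_increments M L" and stat: "stationary_increments M L"
    and cad: "AE \<omega> in M. cadlag (\<lambda>t. L t \<omega>)"
    using levy by (auto simp: levy_process_from_def)
  interpret prob_space M using levy by (simp add: levy_process_from_def)
  have "AE \<omega> in M. L 0 \<omega> = 1 \<and> cadlag (\<lambda>t. L t \<omega>) \<and> no_negative_jumps (\<lambda>t. L t \<omega>)"
    using L0 cad jumps by eventually_elim simp
  then obtain N where N: "N \<in> null_sets M" and "{\<omega> \<in> space M. \<not> (L 0 \<omega> = 1 \<and>
      cadlag (\<lambda>t. L t \<omega>) \<and> no_negative_jumps (\<lambda>t. L t \<omega>))} \<subseteq> N"
    unfolding eventually_ae_filter by blast
  then have good: "L 0 \<omega> = 1" "cadlag (\<lambda>t. L t \<omega>)" "no_negative_jumps (\<lambda>t. L t \<omega>)"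
    if "\<omega> \<in> space M" "\<omega> \<notin> N" for \<omega>
    using that by blast+
  define L' where "L' t \<omega> = (if \<omega> \<in> N then 1 - t else L t \<omega>)" for t \<omega>
  have eq: "AE \<omega> in M. \<forall>t. L' t \<omega> = L t \<omega>"
    using AE_not_in[OF N] by eventually_elim (simp add: L'_def)
  have meas': "L' t \<in> borel_measurable M" if "0 \<le> t" for t
  proof -
    have [measurable]: "L t \<in> borel_measurable M" "N \<in> sets M" using meas[OF that] N by auto
    show ?thesis unfolding L'_def by measurable
  qed
  have step_meas: "(\<lambda>\<omega>. steps 0 h (\<lambda>t. K t \<omega>) i) \<in> borel_measurable M"
    if "0 < h" "\<And>t. 0 \<le> t \<Longrightarrow> K t \<in> borel_measurable M" for h i and K :: "real \<Rightarrow> 'w \<Rightarrow> real"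
    unfolding steps_def using that(1) by (intro borel_measurable_diff that(2)) auto
  have steps_meas: "(\<lambda>\<omega> i. b * steps 0 h (\<lambda>t. K t \<omega>) i) \<in> measurable M seq_borel"
    if "0 < h" "\<And>t. 0 \<le> t \<Longrightarrow> K t \<in> borel_measurable M" for b h and K :: "real \<Rightarrow> 'w \<Rightarrow> real"
    by (rule measurable_PiM_single') (auto intro!: borel_measurable_times step_meas[OF that])
  \<comment> \<open>The factor \<open>b\<close> lets one computation serve twice:
    \<open>b = 1\<close> gives the law of the steps, \<open>b = c\<close> the scaled side of
    self-similarity.\<close>
  have law: "distr M seq_borel (\<lambda>\<omega> i. b * steps 0 h (\<lambda>t. L' t \<omega>) i)
      = Pi\<^sub>M UNIV (\<lambda>_. distr M borel (\<lambda>\<omega>. b * (L h \<omega> - L 0 \<omega>)))" if h: "0 < h" for b h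
  proof -
    let ?X = "\<lambda>i \<omega>. L (h * real (Suc i)) \<omega> - L (h * real i) \<omega>"
    have X: "steps 0 h (\<lambda>t. L t \<omega>) i = ?X i \<omega>" for i \<omega> by (simp add: steps_def)
    have mX: "?X i \<in> borel_measurable M" for i
      by (intro borel_measurable_diff meas) (use h in auto)
    have "distr M seq_borel (\<lambda>\<omega> i. b * steps 0 h (\<lambda>t. L' t \<omega>) i)
        = distr M seq_borel (\<lambda>\<omega> i. b * steps 0 h (\<lambda>t. L t \<omega>) i)"
    proof (rule distr_cong_AE[OF refl refl _ steps_meas[OF h meas'] steps_meas[OF h meas]])
      show "AE \<omega> in M. (\<lambda>i. b * steps 0 h (\<lambda>t. L' t \<omega>) i) = (\<lambda>i. b * steps 0 h (\<lambda>t. L t \<omega>) i)"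
        using eq by eventually_elim simp
    qed
    also have "\<dots> = distr M seq_borel (\<lambda>\<omega> i. b * ?X i \<omega>)" by (simp only: X)
    also have "\<dots> = Pi\<^sub>M UNIV (\<lambda>_. distr M borel (\<lambda>\<omega>. b * (L h \<omega> - L 0 \<omega>)))"
    proof (rule distr_iid_sequence)
      show "random_variable borel (\<lambda>\<omega>. b * ?X i \<omega>)" for i by (intro borel_measurable_times mX) simp
      have "mono (\<lambda>i. h * real i)" using h by (auto intro!: monoI mult_left_mono)
      then have "indep_vars (\<lambda>_. borel) ?X {..<n}" for n
        using ind[unfolded independent_increments_def, rule_format, of "\<lambda>i. h * real i" n] by simp
      then show "indep_vars (\<lambda>_. borel) (\<lambda>i \<omega>. b * ?X i \<omega>) {..<n}" for n
        by (rule indep_vars_compose2[where Y="\<lambda>_ x. b * x"]) simp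
      fix i
      have "distr M borel (?X i) = distr M borel (\<lambda>\<omega>. L h \<omega> - L 0 \<omega>)"
        using stat[unfolded stationary_increments_def, rule_format, of "h * real i" h] h
        by (simp add: distrib_left add.commute)
      moreover have "distr M borel (\<lambda>\<omega>. b * ?X i \<omega>) = distr (distr M borel (?X i)) borel (\<lambda>x. b * x)"
        by (subst distr_distr[OF _ mX]) (simp_all only: comp_def, measurable)
      moreover have "distr M borel (\<lambda>\<omega>. b * (L h \<omega> - L 0 \<omega>))
          = distr (distr M borel (\<lambda>\<omega>. L h \<omega> - L 0 \<omega>)) borel (\<lambda>x. b * x)"
        using h by (subst distr_distr) (auto simp: comp_def intro!: borel_measurable_diff meas)
      ultimately show "distr M borel (\<lambda>\<omega>. b * ?X i \<omega>) = distr M borel (\<lambda>\<omega>. b * (L h \<omega> - L 0 \<omega>))"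
        by simp
    qed
    finally show ?thesis .
  qed
  have "stable_paths M L' \<alpha>"
  proof
    show "0 < \<alpha>" using \<alpha> by simp
    show "L' t \<in> borel_measurable M" if "0 \<le> t" for t by (rule meas'[OF that])
    fix \<omega> assume \<omega>: "\<omega> \<in> space M"
    show "L' 0 \<omega> = 1" using good[OF \<omega>] by (simp add: L'_def)
    show "cadlag (\<lambda>t. L' t \<omega>)" using good[OF \<omega>] cadlag_one_minus by (cases "\<omega> \<in> N") (simp_all add: L'_def)
    show "no_negative_jumps (\<lambda>t. L' t \<omega>)"
      using good[OF \<omega>] no_negative_jumps_one_minus by (cases "\<omega> \<in> N") (simp_all add: L'_def)
  next
    fix h :: real assume h: "0 < h"
    have "distr M borel (\<lambda>\<omega>. 1 * (L h \<omega> - L 0 \<omega>)) = distr M borel (\<lambda>\<omega>. L' h \<omega> - 1)"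
    proof (rule distr_cong_AE[OF refl refl])
      show "AE \<omega> in M. 1 * (L h \<omega> - L 0 \<omega>) = L' h \<omega> - 1" using eq L0 by eventually_elim simp
    qed (use h in \<open>auto intro!: borel_measurable_diff meas meas'\<close>)
    with law[OF h, of 1] show "distr M seq_borel (\<lambda>\<omega>. steps 0 h (\<lambda>t. L' t \<omega>))
        = Pi\<^sub>M UNIV (\<lambda>_. distr M borel (\<lambda>\<omega>. L' h \<omega> - 1))" by simp
  next
    fix c h :: real assume c: "0 < c" and h: "0 < h"
    \<comment> \<open>Both step sequences have product laws, so equality of the one-step marginals
      suffices; stability with the time factor \<open>c powr \<alpha>\<close> gives it.\<close>
    have "(c powr \<alpha>) powr (1 / \<alpha>) = c" using c \<alpha> by (simp add: powr_powr)
    then have "distr M borel (\<lambda>\<omega>. L (c powr \<alpha> * h) \<omega> - L 0 \<omega>) = distr M borel (\<lambda>\<omega>. c * (L h \<omega> - L 0 \<omega>))"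
      using stable[unfolded strictly_stable_def, rule_format, of "c powr \<alpha>" h] c h by simp
    then show "distr M seq_borel (\<lambda>\<omega>. steps 0 (c powr \<alpha> * h) (\<lambda>t. L' t \<omega>))
        = distr M seq_borel (\<lambda>\<omega> i. c * steps 0 h (\<lambda>t. L' t \<omega>) i)"
      using law[of "c powr \<alpha> * h" 1] law[OF h, of c] c h by simp
  next
    show "\<not> (AE \<omega> in M. 1 \<le> L' 1 \<omega>)"
    proof
      \<comment> \<open>Then the Laplace transform of the increment at 1 would be at most 1, but it
        equals e.\<close>
      assume "AE \<omega> in M. 1 \<le> L' 1 \<omega>"
      with eq L0 have le: "AE \<omega> in M. exp (- 1 * (L 1 \<omega> - L 0 \<omega>)) \<le> 1"
        by eventually_elim simp
      have "integrable M (\<lambda>\<omega>. exp (- 1 * (L 1 \<omega> - L 0 \<omega>)))"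
      proof (rule integrable_const_bound[where B=1])
        have [measurable]: "L 1 \<in> borel_measurable M" "L 0 \<in> borel_measurable M" by (simp_all add: meas)
        show "(\<lambda>\<omega>. exp (- 1 * (L 1 \<omega> - L 0 \<omega>))) \<in> borel_measurable M" by measurable
      qed (use le in simp)
      then have "expectation (\<lambda>\<omega>. exp (- 1 * (L 1 \<omega> - L 0 \<omega>))) \<le> expectation (\<lambda>_. 1)"
        using le by (intro integral_mono_AE) auto
      then have "exp (1 powr \<alpha>) \<le> (1::real)" using exp_L[of 1] prob_space by simp
      then show False by simp
    qed
  qed
  with eq that show thesis by blast
qed

theorem corollary1:
  fixes \<alpha> :: real
    and M :: "'w measure"
    and L :: "real \<Rightarrow> 'w \<Rightarrow> real"
  assumes "1 < \<alpha>" and "\<alpha> < 2"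
    and "spectrally_positive_stable_from_one \<alpha> M L"
  shows "self_decomposable (completion M) (area_until_zero L)"
proof -
  obtain L' where L': "stable_paths M L' \<alpha>" and eq: "AE \<omega> in M. \<forall>t. L' t \<omega> = L t \<omega>"
    using stable_paths_modification[OF assms(1,3)] .
  interpret stable_paths M L' \<alpha> by fact
  have "AE \<omega> in M. area_until_zero L \<omega> = area_until_zero L' \<omega>"
    using eq by eventually_elim (simp add: area_until_zero_def)
  with AE_area_until_zero have "AE \<omega> in M. area_until_zero L \<omega> = area \<omega>"
    by eventually_elim simp
  then show ?thesis by (rule self_decomposable_AE_area)
qed

end
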